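(* Let $\mathcal{V}=\{1,\dots,n\}$ and let $\mathbf{Y}=(Y_i)_{i\in\mathcal{V}}$ be a Gauss-Markov random field with dependency graph $\mathcal{G}=(\mathcal{V},\mathcal{E})$, where $\mathcal{G}$ is acyclic, and with positive-definite covariance matrix $\mathbf{\Sigma}=[\Sigma(i,j)]$. Then the elements of the potential matrix $\mathbf{A}:=\mathbf{\Sigma}^{-1}$ are $$A(i,i)=\frac{1}{\Sigma(i,i)}\Bigl(1+\sum_{j\in\mathcal{N}(i)}\frac{\Sigma(i,j)^2}{\Sigma(i,i)\Sigma(j,j)-\Sigma(i,j)^2}\Bigr),\qquad i\in\mathcal{V},$$ and, for $i\ne j$, $$A(i,j)=\begin{cases}\dfrac{-\Sigma(i,j)}{\Sigma(i,i)\Sigma(j,j)-\Sigma(i,j)^2}, & \text{if } (i,j)\in\mathcal{E},\\[2mm] 0,&\text{otherwise.}\end{cases}$$ Moreover, the determinant of $\mathbf{A}$ is $$|\mathbf{A}|=\frac{1}{|\mathbf{\Sigma}|}=\frac{\prod_{i\in\mathcal{V}}\Sigma(i,i)^{\mathrm{Deg}(i)-1}}{\prod_{(i,j)\in\mathcal{E},\,i<j}\bigl[\Sigma(i,i)\Sigma(j,j)-\Sigma(i,j)^2\bigr]}.$$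
   Context: Graphs are simple and undirected. $\mathcal{N}(i)=\{j\in\mathcal{V}: j\neq i,\ (i,j)\in\mathcal{E}\}$ is the set of neighbors of $i$, and $\mathrm{Deg}(i)=|\mathcal{N}(i)|$. $|\cdot|$ applied to a matrix is its determinant. $\mathbf{Y}=(Y_i)_{i\in\mathcal{V}}$ is a Gauss-Markov random field (GMRF) with dependency graph $\mathcal{G}=(\mathcal{V},\mathcal{E})$ if $\mathbf{Y}$ is a Gaussian random vector and, for all $i\neq j$ in $\mathcal{V}$, $Y_i$ and $Y_j$ are conditionally independent given $(Y_k: k\in\mathcal{V},k\ne i,j)$ if and only if $(i,j)\notin\mathcal{E}$. *)

theory Defs
  imports "HOL-Probability.Probability"
begin

text \<open>A graph on the vertex set \<open>UNIV\<close> of a finite type is given by its symmetric and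
  irreflexive edge relation, so that each edge occurs as two ordered pairs.\<close>

definition simple_graph :: "('v \<times> 'v) set \<Rightarrow> bool" where
  "simple_graph E \<longleftrightarrow> sym E \<and> irrefl E"

definition neighbors :: "('v \<times> 'v) set \<Rightarrow> 'v \<Rightarrow> 'v set" where
  "neighbors E i = {j. j \<noteq> i \<and> (i, j) \<in> E}"

definition deg :: "('v \<times> 'v) set \<Rightarrow> 'v \<Rightarrow> nat" where
  "deg E i = card (neighbors E i)"

text \<open>The list \<open>c\<close> holds the vertices of a cycle, the last one being joined to the first. The bound
  on the length excludes walking back and forth along a single edge.\<close>

definition is_cycle :: "('v \<times> 'v) set \<Rightarrow> 'v list \<Rightarrow> bool" where
  "is_cycle E c \<longleftrightarrow> length c \<ge> 3 \<and> distinct c \<and>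
     (\<forall>k<length c. (c ! k, c ! ((k + 1) mod length c)) \<in> E)"

definition acyclic_graph :: "('v \<times> 'v) set \<Rightarrow> bool" where
  "acyclic_graph E \<longleftrightarrow> (\<nexists>c. is_cycle E c)"

text \<open>Degenerate (almost surely constant) variables count as Gaussian.\<close>

definition gaussian_rv :: "'a measure \<Rightarrow> ('a \<Rightarrow> real) \<Rightarrow> bool" where
  "gaussian_rv M X \<longleftrightarrow> X \<in> borel_measurable M \<and>
     ((\<exists>\<mu>. AE \<omega> in M. X \<omega> = \<mu>) \<or>
      (\<exists>\<mu> \<sigma>. 0 < \<sigma> \<and> distributed M lborel X (normal_density \<mu> \<sigma>)))"

text \<open>A random vector is Gaussian if each linear combination of its components is.\<close>

definition gaussian_vector :: "'a measure \<Rightarrow> ('v::finite \<Rightarrow> 'a \<Rightarrow> real) \<Rightarrow> bool" where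
  "gaussian_vector M Y \<longleftrightarrow> (\<forall>a. gaussian_rv M (\<lambda>\<omega>. \<Sum>i\<in>UNIV. a i * Y i \<omega>))"

definition sigma_gen :: "'a measure \<Rightarrow> ('v \<Rightarrow> 'a \<Rightarrow> real) \<Rightarrow> 'v set \<Rightarrow> 'a measure" where
  "sigma_gen M Y K =
     vimage_algebra (space M) (\<lambda>\<omega>. \<lambda>k\<in>K. Y k \<omega>) (PiM K (\<lambda>_. borel))"

text \<open>\<open>P(X \<in> A, Z \<in> B | F) = P(X \<in> A | F) P(Z \<in> B | F)\<close> almost surely, for all Borel sets
  \<open>A\<close> and \<open>B\<close>.\<close>

definition cond_indep ::
  "'a measure \<Rightarrow> 'a measure \<Rightarrow> ('a \<Rightarrow> real) \<Rightarrow> ('a \<Rightarrow> real) \<Rightarrow> bool" where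
  "cond_indep M F X Z \<longleftrightarrow> (\<forall>A\<in>sets borel. \<forall>B\<in>sets borel. AE \<omega> in M.
     real_cond_exp M F (indicator {x \<in> space M. X x \<in> A \<and> Z x \<in> B}) \<omega> =
     real_cond_exp M F (indicator {x \<in> space M. X x \<in> A}) \<omega> *
     real_cond_exp M F (indicator {x \<in> space M. Z x \<in> B}) \<omega>)"

definition GMRF :: "'a measure \<Rightarrow> ('v::finite \<Rightarrow> 'a \<Rightarrow> real) \<Rightarrow> ('v \<times> 'v) set \<Rightarrow> bool" where
  "GMRF M Y E \<longleftrightarrow> gaussian_vector M Y \<and>
     (\<forall>i j. i \<noteq> j \<longrightarrow>
        (cond_indep M (sigma_gen M Y {k. k \<noteq> i \<and> k \<noteq> j}) (Y i) (Y j) \<longleftrightarrow> (i, j) \<notin> E))"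

definition covariance :: "'a measure \<Rightarrow> ('a \<Rightarrow> real) \<Rightarrow> ('a \<Rightarrow> real) \<Rightarrow> real" where
  "covariance M X Z =
     (LINT \<omega>|M. (X \<omega> - (LINT \<omega>'|M. X \<omega>')) * (Z \<omega> - (LINT \<omega>'|M. Z \<omega>')))"

definition cov_matrix :: "'a measure \<Rightarrow> ('v::finite \<Rightarrow> 'a \<Rightarrow> real) \<Rightarrow> real ^ 'v ^ 'v" where
  "cov_matrix M Y = (\<chi> i j. covariance M (Y i) (Y j))"

definition pos_definite :: "real ^ 'v ^ 'v \<Rightarrow> bool" where
  "pos_definite A \<longleftrightarrow> transpose A = A \<and> (\<forall>x. x \<noteq> 0 \<longrightarrow> 0 < x \<bullet> (A *v x))"

end

theory Submission
  imports Defs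
begin

text \<open>Only one half of the Markov property is needed: a missing edge gives a zero of \<open>A\<close>. Let \<open>F\<close>
  be generated by the \<open>Y k\<close>, \<open>k \<noteq> i, j\<close>. The combination \<open>a = A j j * A e_i - A i j * A e_j\<close> has
  no \<open>j\<close> entry, and the centred variable \<open>R\<close> with coefficients \<open>a\<close> is uncorrelated with all these
  \<open>Y k\<close>, so \<open>E[R | F] = 0\<close> by Gaussianity. Conditional independence of \<open>Y i\<close> and \<open>Y j\<close> then makes
  \<open>R\<close> orthogonal to every function of \<open>Y j\<close>; but the covariance of \<open>R\<close> and \<open>Y j\<close> is \<open>- A i j\<close>.

  The rest is linear algebra. An edge of a forest cuts \<open>A\<close> into two blocks joined by a single
  entry, which forces the \<open>2 \<times> 2\<close> formula for that entry; the diagonal follows from \<open>A ** S = mat 1\<close>.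
  Removing the edge replaces \<open>S\<close> by its block diagonal part and changes \<open>A\<close> in four entries only, so
  that Cramer's rule, applied to two columns in turn, yields the determinant by induction on the
  number of edges.\<close>

section \<open>Forests and inverse matrices\<close>

text \<open>A shortest walk from \<open>i\<close> to \<open>m\<close> avoiding the edge would visit
  distinct vertices, and the edge back from \<open>m\<close> to \<open>i\<close> would close it to a
  cycle.\<close>

lemma acyclic_graph_edge_is_bridge:
  assumes E: "simple_graph E" "acyclic_graph E" and im: "(i, m) \<in> E"
  shows "(i, m) \<notin> (E - {(i, m), (m, i)})\<^sup>*"
proof
  let ?F = "E - {(i, m), (m, i)}"
  assume "(i, m) \<in> ?F\<^sup>*"
  then have ex: "\<exists>n. (i, m) \<in> ?F ^^ n"
    by (simp add: rtrancl_power)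
  define n where "n = (LEAST n. (i, m) \<in> ?F ^^ n)"
  have n: "(i, m) \<in> ?F ^^ n"
    unfolding n_def by (rule LeastI_ex[OF ex])
  have least: "n \<le> k" if "(i, m) \<in> ?F ^^ k" for k
    unfolding n_def using that by (rule Least_le)
  obtain f where f: "f 0 = i" "f n = m" and step: "\<And>k. k < n \<Longrightarrow> (f k, f (Suc k)) \<in> ?F"
    using n by (auto simp: relpow_fun_conv)
  have part: "(f p, f q) \<in> ?F ^^ (q - p)" if "p \<le> q" "q \<le> n" for p q
    unfolding relpow_fun_conv using that step
    by (intro exI[of _ "\<lambda>k. f (p + k)"]) auto
  have "i \<noteq> m"
    using E im by (auto simp: simple_graph_def irrefl_def)
  have "n \<noteq> 0"
    using n \<open>i \<noteq> m\<close> by (metis relpow_0_E)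
  \<comment> \<open>A walk of one step would be the deleted edge. From \<open>2 \<le> n\<close> the
    path has the three vertices that a cycle requires.\<close>
  moreover have "n \<noteq> 1"
    using n by auto
  ultimately have "2 \<le> n"
    by linarith
  \<comment> \<open>Skipping the loop between two equal vertices would give a walk shorter than
    \<open>n\<close>.\<close>
  have "f p \<noteq> f q" if "p < q" "q \<le> n" for p q
  proof
    assume eq: "f p = f q"
    have "(i, f p) \<in> ?F ^^ p"
      using part[of 0 p] that f by simp
    moreover have "(f p, m) \<in> ?F ^^ (n - q)"
      using part[of q n] that f eq by simp
    ultimately have "(i, m) \<in> ?F ^^ (p + (n - q))"
      by (auto simp: relpow_add)
    from least[OF this] show False
      using that by linarith
  qed
  then have "inj_on f {0..<Suc n}"
    by (intro linorder_inj_onI) auto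
  then have "distinct (map f [0..<Suc n])"
    by (simp add: distinct_map del: upt_Suc)
  moreover have "(map f [0..<Suc n] ! k, map f [0..<Suc n] ! ((k + 1) mod length (map f [0..<Suc n]))) \<in> E"
    if "k < length (map f [0..<Suc n])" for k
  proof (cases "k = n")
    \<comment> \<open>At the last index the cycle wraps around from \<open>m\<close> to
      \<open>i\<close>, along the deleted edge.\<close>
    case True
    then show ?thesis
      using f E im by (auto simp: simple_graph_def sym_def nth_append)
  next
    case False
    then have "k < n"
      using that by simp
    then show ?thesis
      using step[of k] by (simp del: upt_Suc)
  qed
  ultimately have "is_cycle E (map f [0..<Suc n])"
    unfolding is_cycle_def using \<open>2 \<le> n\<close> by (simp del: upt_Suc)
  with E show False
    by (auto simp: acyclic_graph_def)
qed

text \<open>\<open>C\<close> is the component of \<open>i\<close> once the edge is deleted. An edge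
  of \<open>E\<close> leaving it must be one of the two deleted pairs, and since \<open>m\<close> is
  outside only \<open>(i, m)\<close> remains.\<close>

lemma acyclic_graph_edge_cut:
  assumes E: "simple_graph E" "acyclic_graph E" and im: "(i, m) \<in> E"
  obtains C where "i \<in> C" "m \<notin> C"
    "\<And>k l. k \<in> C \<Longrightarrow> l \<notin> C \<Longrightarrow> (k, l) \<in> E \<Longrightarrow> k = i \<and> l = m"
proof -
  let ?F = "E - {(i, m), (m, i)}"
  let ?C = "{k. (i, k) \<in> ?F\<^sup>*}"
  have m: "m \<notin> ?C"
    using acyclic_graph_edge_is_bridge[OF assms] by simp
  show ?thesis
  proof (rule that[of ?C])
    fix k l
    assume "k \<in> ?C" "l \<notin> ?C" and kl: "(k, l) \<in> E"
    then have "(k, l) \<notin> ?F"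
      by (auto intro: rtrancl_into_rtrancl)
    then show "k = i \<and> l = m"
      using kl m \<open>k \<in> ?C\<close> by auto
  qed (use m in auto)
qed

section \<open>Entries of the inverse of a positive definite matrix\<close>

lemma sum_supported_on_two:
  assumes "i \<noteq> (m::'a::finite)"
  shows "(\<Sum>k\<in>UNIV. (if k = i then a else if k = m then b else 0) * f k) = a * f i + b * (f m :: real)"
proof -
  have "(\<Sum>k\<in>UNIV. (if k = i then a else if k = m then b else 0) * f k)
     = (\<Sum>k\<in>UNIV. (if k = i then a * f k else 0) + (if k = m then b * f k else 0))"
    using assms by (intro sum.cong) auto
  then show ?thesis
    by (simp add: sum.distrib)
qed

lemma pos_definite_sym: "pos_definite S \<Longrightarrow> S $ i $ j = S $ j $ i"
  by (simp add: pos_definite_def transpose_def vec_eq_iff)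

context
  fixes S A :: "real ^ 'n ^ 'n"
  assumes pd: "pos_definite S" and inv: "A ** S = mat 1"
begin

lemma inverse_right: "S ** A = mat 1"
  using inv by (simp add: matrix_left_right_inverse)

lemma inverse_sym: "A $ i $ j = A $ j $ i"
proof -
  have "S ** transpose A = mat 1"
    using arg_cong[OF inv, of transpose] pd
    by (simp add: matrix_transpose_mul pos_definite_def transpose_mat)
  then have "transpose A = A"
    using inv by (metis matrix_mul_assoc matrix_mul_lid matrix_mul_rid)
  then show ?thesis
    by (simp add: transpose_def vec_eq_iff)
qed

lemma inverse_mult_entry: "(\<Sum>k\<in>UNIV. A $ i $ k * S $ k $ j) = (if i = j then 1 else 0)"
  using arg_cong[OF inv, of "\<lambda>M. M $ i $ j"] by (simp add: matrix_matrix_mult_def mat_def)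

lemma quadratic_form_two:
  fixes a b :: real and i m :: 'n
  defines "v \<equiv> (\<chi> k. if k = i then a else if k = m then b else 0) :: real ^ 'n"
  assumes "i \<noteq> m"
  shows "v \<bullet> (S *v v) = a * (a * S $ i $ i + b * S $ i $ m) + b * (a * S $ i $ m + b * S $ m $ m)"
proof -
  have "(S *v v) $ k = a * S $ k $ i + b * S $ k $ m" for k
    using sum_supported_on_two[OF \<open>i \<noteq> m\<close>, of a b "\<lambda>l. S $ k $ l"]
    by (simp add: v_def matrix_vector_mult_def mult.commute)
  then have "v \<bullet> (S *v v) = (\<Sum>k\<in>UNIV. (if k = i then a else if k = m then b else 0)
      * (a * S $ k $ i + b * S $ k $ m))"
    by (simp add: inner_vec_def v_def)
  then show ?thesis
    unfolding sum_supported_on_two[OF \<open>i \<noteq> m\<close>] by (simp add: pos_definite_sym[OF pd, of m i])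
qed

lemma pos_definite_diag_pos: "0 < S $ i $ i"
proof -
  have "0 < axis i 1 \<bullet> (S *v axis i 1)"
    using pd by (auto simp: pos_definite_def axis_eq_0_iff)
  then show ?thesis
    by (simp add: inner_axis' matrix_vector_mul_component inner_axis)
qed

lemma pos_definite_minor_pos:
  assumes "i \<noteq> m"
  shows "0 < S $ i $ i * S $ m $ m - (S $ i $ m)\<^sup>2"
proof -
  \<comment> \<open>For this vector the entry of \<open>S *v ?v\<close> at \<open>i\<close>
    vanishes, so the quadratic form is \<open>S $ i $ i\<close> times the minor.\<close>
  let ?v = "\<chi> k. if k = i then - S $ i $ m else if k = m then S $ i $ i else 0"
  have "?v $ m \<noteq> 0"
    using assms pos_definite_diag_pos[of i] by auto
  then have "?v \<noteq> 0"
    by (metis zero_index)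
  then have "0 < ?v \<bullet> (S *v ?v)"
    using pd by (auto simp: pos_definite_def)
  also have "?v \<bullet> (S *v ?v) = S $ i $ i * (S $ i $ i * S $ m $ m - (S $ i $ m)\<^sup>2)"
    unfolding quadratic_form_two[OF assms] by (simp add: algebra_simps power2_eq_square)
  finally show ?thesis
    using pos_definite_diag_pos[of i] by (simp add: zero_less_mult_iff)
qed

text \<open>The block of \<open>A\<close> on the complement of \<open>C\<close> has trivial kernel:
  \<open>x\<close> lives outside \<open>C\<close> and \<open>A *v x\<close> inside, so the quadratic
  form of \<open>S\<close> at \<open>A *v x\<close> pairs two vectors of disjoint support.\<close>

lemma principal_block_inj:
  assumes "\<And>k. k \<in> C \<Longrightarrow> x $ k = 0" and "\<And>k. k \<notin> C \<Longrightarrow> (A *v x) $ k = 0"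
  shows "x = 0"
proof -
  let ?y = "A *v x"
  have x: "x = S *v ?y"
    by (simp add: matrix_vector_mul_assoc inverse_right)
  have "?y \<bullet> (S *v ?y) = 0"
    unfolding x[symmetric] inner_vec_def using assms by (intro sum.neutral) auto
  then have "?y = 0"
    using pd by (metis less_irrefl pos_definite_def)
  then show ?thesis
    using x by simp
qed

text \<open>As a single entry of \<open>A\<close> crosses the cut, \<open>A\<close> maps columns
  \<open>i\<close> and \<open>m\<close> of \<open>S\<close>, cut down to the complement of
  \<open>C\<close>, to multiples of one axis vector there. Injectivity of the block turns this into
  a linear relation between the two columns. Its row \<open>m\<close> yields the entry of
  \<open>A\<close>; the other rows show that covariances across the edge factor through
  \<open>m\<close>.\<close>

lemma bridge_entries:
  assumes C: "i \<in> C" "m \<notin> C" and cut: "\<And>k l. k \<in> C \<Longrightarrow> l \<notin> C \<Longrightarrow> A $ k $ l \<noteq> 0 \<Longrightarrow> k = i \<and> l = m"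
  shows "A $ i $ m = - S $ i $ m / (S $ i $ i * S $ m $ m - (S $ i $ m)\<^sup>2)"
    and "l \<notin> C \<Longrightarrow> S $ m $ m * S $ i $ l = S $ i $ m * S $ m $ l"
proof -
  let ?a = "A $ i $ m"
  \<comment> \<open>In the rows outside \<open>C\<close>, the truncated columns \<open>i\<close> and
    \<open>m\<close> of \<open>S\<close> are sent to \<open>- d\<close> and \<open>c\<close> times
    the axis vector at \<open>m\<close>; with weights \<open>c\<close> and \<open>d\<close> the
    images cancel.\<close>
  define c where "c = 1 - ?a * S $ i $ m"
  define d where "d = ?a * S $ i $ i"
  define x where "x = (\<chi> k. if k \<in> C then 0 else c * S $ k $ i + d * S $ k $ m)"
  have "(A *v x) $ k = 0" if k: "k \<notin> C" for k
  proof -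
    have A0: "A $ k $ l = (if k = m \<and> l = i then ?a else 0)" if "l \<in> C" for l
      using cut[OF that k] inverse_sym[of k l] by metis
    have part: "(\<Sum>l\<in>C. A $ k $ l * S $ l $ j) = (if k = m then ?a * S $ i $ j else 0)" for j
    proof -
      have "(\<Sum>l\<in>C. A $ k $ l * S $ l $ j) = (\<Sum>l\<in>C. if l = i then (if k = m then ?a * S $ i $ j else 0) else 0)"
        by (intro sum.cong) (auto simp: A0)
      then show ?thesis
        using C by simp
    qed
    have split: "(\<Sum>l\<in>-C. A $ k $ l * S $ l $ j) = (if k = j then 1 else 0) - (if k = m then ?a * S $ i $ j else 0)" for j
      using inverse_mult_entry[of k j] sum.subset_diff[of C UNIV "\<lambda>l. A $ k $ l * S $ l $ j"] part[of j]
      by (simp add: Compl_eq_Diff_UNIV)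
    have "(A *v x) $ k = (\<Sum>l\<in>-C. A $ k $ l * (c * S $ l $ i + d * S $ l $ m))"
      unfolding matrix_vector_mult_def x_def
      by (simp add: if_distrib[of "\<lambda>u. _ * u"] sum.If_cases cong: if_cong)
    also have "\<dots> = c * (\<Sum>l\<in>-C. A $ k $ l * S $ l $ i) + d * (\<Sum>l\<in>-C. A $ k $ l * S $ l $ m)"
      by (simp add: sum_distrib_left sum.distrib algebra_simps)
    also have "\<dots> = 0"
      unfolding split using k C by (auto simp: c_def d_def pos_definite_sym[OF pd])
    finally show ?thesis .
  qed
  then have "x = 0"
    using principal_block_inj[of C x] by (simp add: x_def)
  have *: "c * S $ i $ l + d * S $ m $ l = 0" if "l \<notin> C" for l
  proof -
    have "x $ l = 0"
      unfolding \<open>x = 0\<close> by simp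
    then show ?thesis
      unfolding x_def using that by (simp add: pos_definite_sym[OF pd, of l i] pos_definite_sym[OF pd, of l m])
  qed
  have "i \<noteq> m"
    using C by auto
  \<comment> \<open>This is the relation at \<open>l = m\<close>, which is linear in
    \<open>?a\<close>.\<close>
  have edge: "?a * (S $ i $ i * S $ m $ m - (S $ i $ m)\<^sup>2) = - S $ i $ m"
    using *[OF C(2)] by (simp add: c_def d_def algebra_simps power2_eq_square)
  then show "?a = - S $ i $ m / (S $ i $ i * S $ m $ m - (S $ i $ m)\<^sup>2)"
    using pos_definite_minor_pos[OF \<open>i \<noteq> m\<close>] by (metis less_irrefl nonzero_eq_divide_eq)
  let ?D = "S $ i $ i * S $ m $ m - (S $ i $ m)\<^sup>2"
  assume l: "l \<notin> C"
  \<comment> \<open>Multiplying the relation by \<open>?D\<close> eliminates \<open>?a\<close> from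
    the weights and exposes a common factor \<open>S $ i $ i\<close>.\<close>
  have "?D * c = S $ i $ i * S $ m $ m" "?D * d = - (S $ i $ m * S $ i $ i)"
    using edge by (algebra add: c_def d_def)+
  then have "S $ i $ i * (S $ m $ m * S $ i $ l - S $ i $ m * S $ m $ l) = ?D * (c * S $ i $ l + d * S $ m $ l)"
    by algebra
  then show "S $ m $ m * S $ i $ l = S $ i $ m * S $ m $ l"
    using *[OF l] pos_definite_diag_pos[of i] by simp
qed

lemma forest_inverse_entries:
  assumes E: "simple_graph E" "acyclic_graph E"
    and A0: "\<And>i j. i \<noteq> j \<Longrightarrow> (i, j) \<notin> E \<Longrightarrow> A $ i $ j = 0"
  shows "(i, j) \<in> E \<Longrightarrow> A $ i $ j = - S $ i $ j / (S $ i $ i * S $ j $ j - (S $ i $ j)\<^sup>2)"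
    and "A $ i $ i = 1 / S $ i $ i *
      (1 + (\<Sum>j\<in>neighbors E i. (S $ i $ j)\<^sup>2 / (S $ i $ i * S $ j $ j - (S $ i $ j)\<^sup>2)))"
proof -
  show edge: "A $ i $ j = - S $ i $ j / (S $ i $ i * S $ j $ j - (S $ i $ j)\<^sup>2)"
    if ij: "(i, j) \<in> E" for j
  proof -
    obtain C where C: "i \<in> C" "j \<notin> C"
      "\<And>k l. k \<in> C \<Longrightarrow> l \<notin> C \<Longrightarrow> (k, l) \<in> E \<Longrightarrow> k = i \<and> l = j"
      using acyclic_graph_edge_cut[OF E ij] by metis
    show ?thesis
    proof (rule bridge_entries(1)[OF C(1,2)])
      fix k l
      assume kl: "k \<in> C" "l \<notin> C" "A $ k $ l \<noteq> 0"
      then have "(k, l) \<in> E"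
        using A0[of k l] by auto
      with kl show "k = i \<and> l = j"
        by (intro C(3))
    qed
  qed
  have "i \<notin> neighbors E i"
    by (simp add: neighbors_def)
  have "1 = (\<Sum>k\<in>UNIV. A $ i $ k * S $ k $ i)"
    by (simp add: inverse_mult_entry)
  also have "\<dots> = (\<Sum>k\<in>insert i (neighbors E i). A $ i $ k * S $ k $ i)"
    by (intro sum.mono_neutral_right) (auto simp: neighbors_def, metis A0)
  also have "\<dots> = A $ i $ i * S $ i $ i + (\<Sum>j\<in>neighbors E i. A $ i $ j * S $ j $ i)"
    using \<open>i \<notin> neighbors E i\<close> by simp
  also have "(\<Sum>j\<in>neighbors E i. A $ i $ j * S $ j $ i)
      = - (\<Sum>j\<in>neighbors E i. (S $ i $ j)\<^sup>2 / (S $ i $ i * S $ j $ j - (S $ i $ j)\<^sup>2))"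
    unfolding sum_negf[symmetric]
  proof (intro sum.cong refl)
    fix j
    assume "j \<in> neighbors E i"
    then show "A $ i $ j * S $ j $ i = - ((S $ i $ j)\<^sup>2 / (S $ i $ i * S $ j $ j - (S $ i $ j)\<^sup>2))"
      using pos_definite_sym[OF pd, of j i] by (simp add: neighbors_def edge power2_eq_square)
  qed
  finally show "A $ i $ i = 1 / S $ i $ i *
      (1 + (\<Sum>j\<in>neighbors E i. (S $ i $ j)\<^sup>2 / (S $ i $ i * S $ j $ j - (S $ i $ j)\<^sup>2)))"
    using pos_definite_diag_pos[of i] by (simp add: field_simps)
qed

end

section \<open>Determinants when an edge is removed\<close>

text \<open>Cramer's rule, with the solution of \<open>B *v x = v\<close> expressed through the
  inverse as \<open>x = W *v v\<close>.\<close>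

lemma det_replace_column:
  fixes B W :: "real ^ 'n ^ 'n"
  assumes "B ** W = mat 1"
  shows "det (\<chi> k l. if l = j then v $ k else B $ k $ l) = (W *v v) $ j * det B"
proof -
  have "B *v (W *v v) = v"
    using assms by (simp add: matrix_vector_mul_assoc)
  then show ?thesis
    using cramer_lemma[of j B "W *v v"] by (simp only:)
qed

text \<open>The block diagonal part of \<open>S\<close> for the partition into \<open>C\<close> and
  \<open>- C\<close>. Keeping the full index type lets the induction over edges stay among matrices
  of one type.\<close>

definition block_restrict :: "'n set \<Rightarrow> real ^ 'n ^ 'n \<Rightarrow> real ^ 'n ^ 'n" where
  "block_restrict C S = (\<chi> k l. if k \<in> C \<longleftrightarrow> l \<in> C then S $ k $ l else 0)"

text \<open>The diagonal correction is the edge's summand in the formula for \<open>A i i\<close>, so that the result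
  is the inverse of \<open>block_restrict C S\<close>.\<close>

definition bridge_removed :: "real ^ 'n ^ 'n \<Rightarrow> real ^ 'n ^ 'n \<Rightarrow> 'n \<Rightarrow> 'n \<Rightarrow> real ^ 'n ^ 'n" where
  "bridge_removed S A i m = (\<chi> k l. A $ k $ l
     - (if k = i \<and> l = m \<or> k = m \<and> l = i then A $ i $ m else 0)
     - (if k = l \<and> (k = i \<or> k = m)
        then (S $ i $ m)\<^sup>2 / (S $ k $ k * (S $ i $ i * S $ m $ m - (S $ i $ m)\<^sup>2)) else 0))"

text \<open>The quadratic form is the sum of those of \<open>S\<close> at the parts of
  \<open>x\<close> on \<open>C\<close> and off \<open>C\<close>, at least one of which is
  nonzero.\<close>

lemma pos_definite_block_restrict:
  fixes S :: "real ^ 'n ^ 'n"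
  assumes pd: "pos_definite S"
  shows "pos_definite (block_restrict C S)"
  unfolding pos_definite_def
proof (intro conjI allI impI)
  show "transpose (block_restrict C S) = block_restrict C S"
    using pos_definite_sym[OF pd] by (auto simp: transpose_def block_restrict_def vec_eq_iff)
  fix x :: "real ^ 'n"
  assume "x \<noteq> 0"
  define y z where "y = (\<chi> k. if k \<in> C then x $ k else 0)" and "z = (\<chi> k. if k \<in> C then 0 else x $ k)"
  have quad: "u \<bullet> (T *v u) = (\<Sum>k\<in>UNIV. \<Sum>l\<in>UNIV. u $ k * (T $ k $ l * u $ l))"
    for u :: "real ^ 'n" and T
    by (simp add: inner_vec_def matrix_vector_mult_def sum_distrib_left)
  have "x \<bullet> (block_restrict C S *v x) = y \<bullet> (S *v y) + z \<bullet> (S *v z)"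
    unfolding quad sum.distrib[symmetric]
    by (intro sum.cong) (auto simp: y_def z_def block_restrict_def)
  moreover have "y \<noteq> 0 \<or> z \<noteq> 0"
  proof (rule ccontr)
    assume "\<not> (y \<noteq> 0 \<or> z \<noteq> 0)"
    then have "y + z = 0"
      by simp
    moreover have "y + z = x"
      by (simp add: y_def z_def vec_eq_iff)
    ultimately show False
      using \<open>x \<noteq> 0\<close> by simp
  qed
  moreover have "0 \<le> u \<bullet> (S *v u)" "u \<noteq> 0 \<Longrightarrow> 0 < u \<bullet> (S *v u)" for u
    using pd by (cases "u = 0"; auto simp: pos_definite_def less_imp_le)+
  ultimately show "0 < x \<bullet> (block_restrict C S *v x)"
    by (metis add_nonneg_pos add_pos_nonneg)
qed

context
  fixes S A :: "real ^ 'n ^ 'n" and i m :: 'n and C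
  assumes pd: "pos_definite S" and inv: "A ** S = mat 1"
    and C: "i \<in> C" "m \<notin> C"
    and cut: "\<And>k l. k \<in> C \<Longrightarrow> l \<notin> C \<Longrightarrow> A $ k $ l \<noteq> 0 \<Longrightarrow> k = i \<and> l = m"
begin

text \<open>Among the rows in \<open>C\<close> only row \<open>i\<close> changes. It loses its entry
  towards \<open>m\<close>, and the diagonal correction makes up for this because covariances factor
  through the ends of the edge. The lemma has a context of its own so that it serves both sides of
  the cut.\<close>

lemma bridge_removed_inverse_row:
  assumes k: "k \<in> C"
  shows "(\<Sum>p\<in>UNIV. bridge_removed S A i m $ k $ p * block_restrict C S $ p $ l) = (if k = l then 1 else 0)"
proof -
  let ?D = "S $ i $ i * S $ m $ m - (S $ i $ m)\<^sup>2"
  let ?e = "(S $ i $ m)\<^sup>2 / (S $ i $ i * ?D)"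
  note Ssym = pos_definite_sym[OF pd] and Asym = inverse_sym[OF pd inv]
  have im: "i \<noteq> m"
    using C by auto
  have D: "?D > 0" and Sii: "S $ i $ i > 0"
    using pos_definite_minor_pos[OF pd inv im] pos_definite_diag_pos[OF pd inv] by auto
  have a: "A $ i $ m = - S $ i $ m / ?D"
    by (rule bridge_entries(1)[OF pd inv C cut])
  \<comment> \<open>The factorisation in \<open>bridge_entries\<close>, seen from the other side:
    \<open>m\<close>, \<open>i\<close> and \<open>- C\<close> take the roles of \<open>i\<close>,
    \<open>m\<close> and \<open>C\<close>.\<close>
  have sep: "S $ i $ i * S $ m $ l = S $ i $ m * S $ i $ l" if "l \<in> C"
  proof -
    have "S $ i $ i * S $ m $ l = S $ m $ i * S $ i $ l"
    proof (rule bridge_entries(2)[OF pd inv, of m "- C"])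
      fix k l
      assume "k \<in> - C" "l \<notin> - C" "A $ k $ l \<noteq> 0"
      then show "k = m \<and> l = i"
        using cut[of l k] Asym[of k l] by auto
    qed (use C that in auto)
    then show ?thesis
      by (simp add: Ssym[of m i])
  qed
  \<comment> \<open>On columns in \<open>C\<close> the diagonal correction replaces the contribution
    of the lost entry.\<close>
  have e: "A $ i $ m * S $ m $ l + ?e * S $ i $ l = 0" if "l \<in> C"
  proof -
    have cancel: "- t / d * x + t\<^sup>2 / (s * d) * y = 0"
      if "d > 0" "s > 0" "s * x = t * y" for t d s x y :: real
    proof -
      have "x = t * y / s"
        using that by (simp add: eq_divide_eq mult.commute)
      then show ?thesis
        using that by (simp add: power2_eq_square)
    qed
    show ?thesis
      unfolding a by (rule cancel[OF D Sii sep[OF that]])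
  qed
  have A0: "A $ k $ p = (if k = i \<and> p = m then A $ i $ m else 0)" if "p \<in> - C" for p
    using cut[OF k, of p] that by (metis ComplD)
  have outer: "(\<Sum>p\<in>-C. A $ k $ p * S $ p $ l) = (if k = i then A $ i $ m * S $ m $ l else 0)"
  proof -
    have "(\<Sum>p\<in>-C. A $ k $ p * S $ p $ l)
        = (\<Sum>p\<in>-C. if p = m then (if k = i then A $ i $ m * S $ m $ l else 0) else 0)"
      by (intro sum.cong) (auto simp: A0)
    then show ?thesis
      using C by simp
  qed
  have inner: "(\<Sum>p\<in>C. A $ k $ p * S $ p $ l) = (if k = l then 1 else 0) - (if k = i then A $ i $ m * S $ m $ l else 0)"
    using inverse_mult_entry[OF pd inv, of k l] sum.subset_diff[of C UNIV "\<lambda>p. A $ k $ p * S $ p $ l"] outer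
    by (simp add: Compl_eq_Diff_UNIV)
  have block: "(\<Sum>p\<in>UNIV. A $ k $ p * block_restrict C S $ p $ l)
      = (if l \<in> C then (\<Sum>p\<in>C. A $ k $ p * S $ p $ l) else (\<Sum>p\<in>-C. A $ k $ p * S $ p $ l))"
    by (simp add: block_restrict_def if_distrib[of "\<lambda>u. _ * u"] sum.If_cases Compl_eq cong: if_cong)
  have km: "k \<noteq> m"
    using k C by auto
  have "(\<Sum>p\<in>UNIV. bridge_removed S A i m $ k $ p * block_restrict C S $ p $ l)
    = (\<Sum>p\<in>UNIV. A $ k $ p * block_restrict C S $ p $ l
        - (if p = m then (if k = i then A $ i $ m * block_restrict C S $ m $ l else 0) else 0)
        - (if p = i then (if k = i then ?e * block_restrict C S $ i $ l else 0) else 0))"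
    using km by (intro sum.cong) (auto simp: bridge_removed_def left_diff_distrib)
  also have "\<dots> = (\<Sum>p\<in>UNIV. A $ k $ p * block_restrict C S $ p $ l)
        - (if k = i then A $ i $ m * block_restrict C S $ m $ l else 0)
        - (if k = i then ?e * block_restrict C S $ i $ l else 0)"
    by (simp add: sum_subtractf)
  also have "\<dots> = (if k = l then 1 else 0)"
    unfolding block outer inner using e k C by (auto simp: block_restrict_def)
  finally show ?thesis .
qed

end

context
  fixes S A :: "real ^ 'n ^ 'n" and i m :: 'n and C
  assumes pd: "pos_definite S" and inv: "A ** S = mat 1"
    and C: "i \<in> C" "m \<notin> C"
    and cut: "\<And>k l. k \<in> C \<Longrightarrow> l \<notin> C \<Longrightarrow> A $ k $ l \<noteq> 0 \<Longrightarrow> k = i \<and> l = m"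
begin

text \<open>Rows outside \<open>C\<close> come from the row lemma with \<open>i\<close> and
  \<open>m\<close> exchanged and \<open>- C\<close> for \<open>C\<close>, which leaves both matrices
  unchanged.\<close>

lemma bridge_removed_inverse: "bridge_removed S A i m ** block_restrict C S = mat 1"
proof -
  note Ssym = pos_definite_sym[OF pd] and Asym = inverse_sym[OF pd inv]
  have "(\<Sum>p\<in>UNIV. bridge_removed S A i m $ k $ p * block_restrict C S $ p $ l) = (if k = l then 1 else 0)" for k l
  proof (cases "k \<in> C")
    case True
    then show ?thesis
      using bridge_removed_inverse_row[OF pd inv C cut] by blast
  next
    case False
    have swap: "bridge_removed S A m i = bridge_removed S A i m"
      by (auto simp: bridge_removed_def vec_eq_iff Ssym[of m i] Asym[of m i] mult.commute)
    have compl: "block_restrict (- C) S = block_restrict C S"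
      by (simp add: block_restrict_def)
    have "k \<in> - C"
      using False by simp
    show ?thesis
    proof (rule bridge_removed_inverse_row[OF pd inv, of m "- C" i k l, unfolded swap compl])
      fix k l
      assume "k \<in> - C" "l \<notin> - C" "A $ k $ l \<noteq> 0"
      then show "k = m \<and> l = i"
        using cut[of l k] Asym[of k l] by auto
    qed (use C False in auto)
  qed
  then show ?thesis
    by (simp add: matrix_matrix_mult_def mat_def vec_eq_iff)
qed

text \<open>\<open>A\<close> and \<open>bridge_removed S A i m\<close> differ in columns
  \<open>i\<close> and \<open>m\<close> only. The intermediate matrix \<open>?Q\<close> has column
  \<open>m\<close> exchanged and column \<open>i\<close> still from \<open>A\<close>, so Cramer's
  rule applies from either end.\<close>

lemma det_bridge_removed:
  "det A = det (bridge_removed S A i m) *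
     (S $ i $ i * S $ m $ m / (S $ i $ i * S $ m $ m - (S $ i $ m)\<^sup>2))"
proof -
  let ?B = "bridge_removed S A i m" and ?T = "block_restrict C S"
  let ?D = "S $ i $ i * S $ m $ m - (S $ i $ m)\<^sup>2"
  note Ssym = pos_definite_sym[OF pd]
  have im: "i \<noteq> m"
    using C by auto
  have D: "?D > 0" and Sp: "S $ i $ i > 0" "S $ m $ m > 0"
    using pos_definite_minor_pos[OF pd inv im] pos_definite_diag_pos[OF pd inv] by auto
  have a: "A $ i $ m = - S $ i $ m / ?D"
    by (rule bridge_entries(1)[OF pd inv C cut])
  have SA: "(\<Sum>k\<in>UNIV. S $ p $ k * A $ k $ p) = 1" for p
    using arg_cong[OF inverse_right[OF pd inv], of "\<lambda>M. M $ p $ p"] by (simp add: matrix_matrix_mult_def mat_def)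
  have TB: "(\<Sum>k\<in>UNIV. ?T $ p $ k * ?B $ k $ p) = 1" for p
  proof -
    have "?T ** ?B = mat 1"
      using bridge_removed_inverse by (simp add: matrix_left_right_inverse)
    from arg_cong[OF this, of "\<lambda>M. M $ p $ p"] show ?thesis
      by (simp add: matrix_matrix_mult_def mat_def)
  qed
  let ?Q = "\<chi> k l. if l = m then column m ?B $ k else A $ k $ l"
  \<comment> \<open>In column \<open>m\<close> the lost entry and the diagonal correction cancel, so
    this exchange preserves the determinant.\<close>
  have "(S *v column m ?B) $ m = (\<Sum>k\<in>UNIV. S $ m $ k * A $ k $ m
      - (if k = i then S $ m $ i * A $ i $ m else 0)
      - (if k = m then S $ m $ m * ((S $ i $ m)\<^sup>2 / (S $ m $ m * ?D)) else 0))"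
    unfolding matrix_vector_mult_def column_def using im
    by (auto intro!: sum.cong simp: bridge_removed_def right_diff_distrib)
  also have "\<dots> = 1 - S $ m $ i * A $ i $ m - S $ m $ m * ((S $ i $ m)\<^sup>2 / (S $ m $ m * ?D))"
    by (simp add: sum_subtractf SA)
  also have "\<dots> = 1"
    unfolding a using D Sp by (simp add: Ssym[of m i] power2_eq_square)
  finally have "det ?Q = det A"
    by (simp add: det_replace_column[OF inv])
  have Q: "?Q = (\<chi> k l. if l = i then column i A $ k else ?B $ k $ l)"
    using im by (auto simp: vec_eq_iff column_def bridge_removed_def)
  \<comment> \<open>This exchange yields the whole factor: \<open>?T\<close> vanishes at
    \<open>(i, m)\<close>, so only the diagonal correction counts.\<close>
  have "(?T *v column i A) $ i = (\<Sum>k\<in>UNIV. ?T $ i $ k * ?B $ k $ i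
      + (if k = i then S $ i $ i * ((S $ i $ m)\<^sup>2 / (S $ i $ i * ?D)) else 0))"
    unfolding matrix_vector_mult_def column_def using im C
    by (auto intro!: sum.cong simp: bridge_removed_def block_restrict_def right_diff_distrib)
  also have "\<dots> = 1 + S $ i $ i * ((S $ i $ m)\<^sup>2 / (S $ i $ i * ?D))"
    by (simp add: sum.distrib TB)
  also have "\<dots> = S $ i $ i * S $ m $ m / ?D"
    using D Sp by (simp add: field_simps)
  finally have "det ?Q = S $ i $ i * S $ m $ m / ?D * det ?B"
    unfolding Q det_replace_column[OF bridge_removed_inverse] by simp
  then show ?thesis
    using \<open>det ?Q = det A\<close> by simp
qed

end

text \<open>Stated for arbitrary matrices, so that the induction can pass to
  \<open>block_restrict C S\<close> and \<open>bridge_removed S A i m\<close>. The removed edge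
  accounts for one more power of the variance at each of its ends and for its own minor in the
  denominator.\<close>

lemma forest_inverse_det:
  fixes S A :: "real ^ 'n::{finite,linorder} ^ 'n::{finite,linorder}"
  assumes "pos_definite S" "A ** S = mat 1" "simple_graph E" "acyclic_graph E"
    and "\<And>i j. i \<noteq> j \<Longrightarrow> (i, j) \<notin> E \<Longrightarrow> A $ i $ j = 0"
  shows "det A = (\<Prod>i\<in>UNIV. S $ i $ i powi (int (deg E i) - 1)) /
      (\<Prod>(i, j)\<in>{(i, j). (i, j) \<in> E \<and> i < j}. S $ i $ i * S $ j $ j - (S $ i $ j)\<^sup>2)"
  using assms
proof (induction "card E" arbitrary: E S A rule: less_induct)
  case less
  note pd = \<open>pos_definite S\<close> and inv = \<open>A ** S = mat 1\<close>
    and E = \<open>simple_graph E\<close> \<open>acyclic_graph E\<close> and A0 = less.prems(5)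
  show ?case
  proof (cases "E = {}")
    case True
    \<comment> \<open>Without edges all degrees are 0, and the exponent -1 matches the diagonal
      entries \<open>1 / S $ i $ i\<close>.\<close>
    have "det A = (\<Prod>i\<in>UNIV. A $ i $ i)"
      using A0 True by (intro det_diagonal) auto
    then show ?thesis
      using True forest_inverse_entries(2)[OF pd inv E A0]
      by (simp add: deg_def neighbors_def power_int_minus divide_inverse)
  next
    case False
    then obtain k l where kl: "(k, l) \<in> E"
      by auto
    then have "(l, k) \<in> E" "k \<noteq> l"
      using E(1) by (auto simp: simple_graph_def sym_def irrefl_def)
    with kl obtain i m where im: "(i, m) \<in> E" "(m, i) \<in> E" "i < m"
      by (meson linorder_neqE)
    obtain C where C: "i \<in> C" "m \<notin> C"
      and cutE: "\<And>k l. k \<in> C \<Longrightarrow> l \<notin> C \<Longrightarrow> (k, l) \<in> E \<Longrightarrow> k = i \<and> l = m"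
      using acyclic_graph_edge_cut[OF E im(1)] by metis
    have cut: "k = i \<and> l = m" if "k \<in> C" "l \<notin> C" "A $ k $ l \<noteq> 0" for k l
    proof -
      have "(k, l) \<in> E"
        using A0[of k l] that by auto
      then show ?thesis
        using cutE that by blast
    qed
    let ?F = "E - {(i, m), (m, i)}" and ?B = "bridge_removed S A i m" and ?T = "block_restrict C S"
    let ?D = "\<lambda>(i, j). S $ i $ i * S $ j $ j - (S $ i $ j)\<^sup>2"
    have F: "simple_graph ?F" "acyclic_graph ?F"
      using E by (auto simp: simple_graph_def acyclic_graph_def is_cycle_def sym_def irrefl_def)
    \<comment> \<open>Every remaining edge lies on one side of the cut, where \<open>?T\<close>
      agrees with \<open>S\<close>, so its minor is unchanged.\<close>
    have side: "k \<in> C \<longleftrightarrow> l \<in> C" if "(k, l) \<in> ?F" for k l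
      using that cutE[of k l] cutE[of l k] E(1) by (auto simp: simple_graph_def sym_def)
    have IH: "det ?B = (\<Prod>k\<in>UNIV. ?T $ k $ k powi (int (deg ?F k) - 1)) /
        (\<Prod>(k, l)\<in>{(k, l). (k, l) \<in> ?F \<and> k < l}. ?T $ k $ k * ?T $ l $ l - (?T $ k $ l)\<^sup>2)"
    proof (rule less.hyps)
      show "card ?F < card E"
        using im by (intro psubset_card_mono) auto
      show "?B $ k $ l = 0" if "k \<noteq> l" "(k, l) \<notin> ?F" for k l
        using that A0[of k l] inverse_sym[OF pd inv, of i m] by (auto simp: bridge_removed_def)
      show "?B ** ?T = mat 1"
        by (rule bridge_removed_inverse[OF pd inv C cut])
    qed (use F pos_definite_block_restrict[OF pd] in auto)
    have "?T $ k $ k = S $ k $ k" for k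
      by (simp add: block_restrict_def)
    moreover have "(\<Prod>(k, l)\<in>{(k, l). (k, l) \<in> ?F \<and> k < l}. ?T $ k $ k * ?T $ l $ l - (?T $ k $ l)\<^sup>2)
        = prod ?D {(k, l). (k, l) \<in> ?F \<and> k < l}"
      using side by (intro prod.cong) (auto simp: block_restrict_def)
    ultimately have IH': "det ?B = (\<Prod>k\<in>UNIV. S $ k $ k powi (int (deg ?F k) - 1))
        / prod ?D {(k, l). (k, l) \<in> ?F \<and> k < l}"
      using IH by simp
    have "{(k, l). (k, l) \<in> E \<and> k < l} = insert (i, m) {(k, l). (k, l) \<in> ?F \<and> k < l}"
      using im by auto
    then have edges: "prod ?D {(k, l). (k, l) \<in> E \<and> k < l}
        = ?D (i, m) * prod ?D {(k, l). (k, l) \<in> ?F \<and> k < l}"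
      by simp
    have degF: "int (deg E k) - 1 = (int (deg ?F k) - 1) + (if k = i \<or> k = m then 1 else 0)" for k
    proof -
      have "neighbors E i = insert m (neighbors ?F i)" "m \<notin> neighbors ?F i"
        "neighbors E m = insert i (neighbors ?F m)" "i \<notin> neighbors ?F m"
        "k \<noteq> i \<Longrightarrow> k \<noteq> m \<Longrightarrow> neighbors ?F k = neighbors E k"
        using im by (auto simp: neighbors_def)
      then show ?thesis
        by (auto simp: deg_def)
    qed
    have Sp: "S $ k $ k > 0" for k
      by (rule pos_definite_diag_pos[OF pd inv])
    have "(\<Prod>k\<in>UNIV. S $ k $ k powi (int (deg E k) - 1))
        = (\<Prod>k\<in>UNIV. S $ k $ k powi (int (deg ?F k) - 1) * (if k \<in> {i, m} then S $ k $ k else 1))"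
      unfolding degF by (intro prod.cong) (auto simp: power_int_add less_imp_neq[OF Sp, symmetric])
    also have "\<dots> = (\<Prod>k\<in>UNIV. S $ k $ k powi (int (deg ?F k) - 1)) * (\<Prod>k\<in>{i, m}. S $ k $ k)"
      unfolding prod.distrib by (simp only: prod.inter_restrict[symmetric] finite Int_UNIV_left)
    also have "(\<Prod>k\<in>{i, m}. S $ k $ k) = S $ i $ i * S $ m $ m"
      using im by simp
    finally show ?thesis
      using det_bridge_removed[OF pd inv C cut] unfolding IH' edges by simp
  qed
qed

section \<open>Gaussian vectors and conditional independence\<close>

context prob_space
begin

section \<open>Uniqueness of Fourier transforms\<close>

lemma integrable_iexp_mult:
  fixes G :: "'a \<Rightarrow> complex"
  assumes "integrable M G" and [measurable]: "f \<in> borel_measurable M"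
  shows "integrable M (\<lambda>\<omega>. G \<omega> * iexp (f \<omega>))"
  by (rule Bochner_Integration.integrable_bound[OF assms(1)])
    (use assms in \<open>auto simp: norm_mult\<close>)

lemma integrable_mult_indicator_comp:
  fixes G :: "'a \<Rightarrow> 'b::{banach, second_countable_topology, real_normed_algebra_1}"
  assumes "integrable M G" and [measurable]: "Y \<in> measurable M N" "B \<in> sets N"
  shows "integrable M (\<lambda>\<omega>. G \<omega> * indicator B (Y \<omega>))"
  by (rule Bochner_Integration.integrable_bound[OF assms(1)])
    (use assms in \<open>auto simp: indicator_def\<close>)

text \<open>Levy's uniqueness theorem, applied to the positive and the negative part of \<open>H\<close> taken as
  densities and normalised to the same mass, which is their common value at \<open>t = 0\<close>.\<close>

lemma fourier_uniqueness_real: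
  fixes H Y :: "'a \<Rightarrow> real"
  assumes H: "integrable M H" and Y [measurable]: "Y \<in> borel_measurable M"
    and ft: "\<And>t. (CLINT \<omega>|M. H \<omega> * iexp (t * Y \<omega>)) = 0"
    and B [measurable]: "B \<in> sets borel"
  shows "(LINT \<omega>|M. H \<omega> * indicator B (Y \<omega>)) = 0"
proof -
  define P N where "P = (\<lambda>\<omega>. max 0 (H \<omega>))" and "N = (\<lambda>\<omega>. max 0 (- H \<omega>))"
  have Hm [measurable]: "H \<in> borel_measurable M"
    using H by auto
  have PN [measurable]: "integrable M P" "integrable M N" and HPN: "H \<omega> = P \<omega> - N \<omega>"
    and nonneg: "0 \<le> P \<omega>" "0 \<le> N \<omega>" for \<omega>
    using H by (auto simp: P_def N_def)
  define c where "c = integral\<^sup>L M P"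
  have "integral\<^sup>L M H = 0"
    using ft[of 0] by simp
  then have c: "integral\<^sup>L M N = c"
    using PN by (simp add: c_def HPN[abs_def] Bochner_Integration.integral_diff)
  show ?thesis
  proof (cases "c = 0")
    \<comment> \<open>There is no mass to normalise, but both parts vanish almost
      everywhere.\<close>
    case True
    then have "AE \<omega> in M. P \<omega> = 0" "AE \<omega> in M. N \<omega> = 0"
      using c c_def PN nonneg integral_nonneg_eq_0_iff_AE by (metis AE_I2)+
    then have "AE \<omega> in M. H \<omega> = 0"
      by eventually_elim (simp add: HPN)
    then have "AE \<omega> in M. H \<omega> * indicator B (Y \<omega>) = 0"
      by eventually_elim simp
    then show ?thesis
      by (subst integral_cong_AE[of _ _ "\<lambda>_. 0"]) auto
  next
    case False
    have "0 \<le> c"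
      unfolding c_def using nonneg by (intro Bochner_Integration.integral_nonneg) auto
    with False have "0 < c"
      by simp
    define \<mu> where "\<mu> Q = distr (density M (\<lambda>\<omega>. ennreal (Q \<omega> / c))) borel Y" for Q
    have dist: "real_distribution (\<mu> Q)"
      if [measurable]: "integrable M Q" and "\<And>\<omega>. 0 \<le> Q \<omega>" "integral\<^sup>L M Q = c" for Q
    proof -
      have "(\<integral>\<^sup>+\<omega>. ennreal (Q \<omega> / c) \<partial>M) = ennreal (integral\<^sup>L M (\<lambda>\<omega>. Q \<omega> / c))"
        using that \<open>0 < c\<close> by (intro nn_integral_eq_integral) auto
      then have "prob_space (density M (\<lambda>\<omega>. ennreal (Q \<omega> / c)))"
        using that \<open>0 < c\<close> by (intro prob_spaceI) (simp add: emeasure_density cong: nn_integral_cong)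
      then show ?thesis
        unfolding \<mu>_def by (intro prob_space.real_distribution_distr) auto
    qed
    have int: "(LINT x|\<mu> Q. f x) = (LINT \<omega>|M. (Q \<omega> / c) *\<^sub>R f (Y \<omega>))"
      if [measurable]: "integrable M Q" and "\<And>\<omega>. 0 \<le> Q \<omega>" and [measurable]: "f \<in> borel_measurable borel"
      for Q and f :: "real \<Rightarrow> 'b::{banach, second_countable_topology}"
      unfolding \<mu>_def using that \<open>0 < c\<close> by (subst integral_distr) (auto simp: integral_density)
    have "char (\<mu> P) = char (\<mu> N)"
    proof
      fix t
      have i: "integrable M (\<lambda>\<omega>. (Q \<omega> / c) *\<^sub>R iexp (t * Y \<omega>))" if "integrable M Q" for Q :: "'a \<Rightarrow> real"
        using integrable_iexp_mult[of "\<lambda>\<omega>. Q \<omega> / c" "\<lambda>\<omega>. t * Y \<omega>"] that by (simp add: scaleR_conv_of_real)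
      have "char (\<mu> P) t - char (\<mu> N) t
          = (LINT \<omega>|M. (P \<omega> / c) *\<^sub>R iexp (t * Y \<omega>) - (N \<omega> / c) *\<^sub>R iexp (t * Y \<omega>))"
        unfolding char_def Bochner_Integration.integral_diff[OF i[OF PN(1)] i[OF PN(2)]]
        using PN nonneg by (subst (1 2) int) auto
      also have "\<dots> = (LINT \<omega>|M. (H \<omega> * iexp (t * Y \<omega>)) / c)"
        by (intro Bochner_Integration.integral_cong)
          (auto simp: HPN scaleR_conv_of_real diff_divide_distrib left_diff_distrib)
      also have "\<dots> = 0"
        using ft[of t] by simp
      finally show "char (\<mu> P) t = char (\<mu> N) t"
        by simp
    qed
    then have eq: "\<mu> P = \<mu> N"
      using dist PN nonneg c c_def by (intro Levy_uniqueness) auto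
    have i: "integrable M (\<lambda>\<omega>. Q \<omega> / c * indicator B (Y \<omega>))" if "integrable M Q" for Q :: "'a \<Rightarrow> real"
      using that by (intro integrable_mult_indicator_comp[OF _ Y B]) simp
    have "(LINT \<omega>|M. H \<omega> * indicator B (Y \<omega>)) / c
        = (LINT \<omega>|M. P \<omega> / c * indicator B (Y \<omega>) - N \<omega> / c * indicator B (Y \<omega>))"
      unfolding integral_divide_zero[symmetric]
      by (intro Bochner_Integration.integral_cong) (auto simp: HPN diff_divide_distrib left_diff_distrib)
    also have "\<dots> = (LINT x|\<mu> P. indicator B x) - (LINT x|\<mu> N. indicator B x)"
      using PN nonneg i by (subst (1 2) int) auto
    finally show ?thesis
      using eq \<open>0 < c\<close> by simp
  qed
qed

text \<open>The transform of \<open>cnj G\<close> at \<open>t\<close> is the conjugate of that of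
  \<open>G\<close> at \<open>- t\<close>, so the transforms of \<open>Re G\<close> and
  \<open>Im G\<close> vanish too and the real case applies to each. Complex weights arise once a
  character is absorbed into the weight.\<close>

lemma fourier_uniqueness_complex:
  fixes G :: "'a \<Rightarrow> complex" and Y :: "'a \<Rightarrow> real"
  assumes G: "integrable M G" and Y [measurable]: "Y \<in> borel_measurable M"
    and ft: "\<And>t. (CLINT \<omega>|M. G \<omega> * iexp (t * Y \<omega>)) = 0"
    and B [measurable]: "B \<in> sets borel"
  shows "(CLINT \<omega>|M. G \<omega> * indicator B (Y \<omega>)) = 0"
proof -
  have i: "integrable M (\<lambda>\<omega>. G \<omega> * iexp (t * Y \<omega>))" for t
    using G by (intro integrable_iexp_mult) auto
  have ft': "(CLINT \<omega>|M. cnj (G \<omega>) * iexp (t * Y \<omega>)) = 0" for t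
  proof -
    have "(CLINT \<omega>|M. cnj (G \<omega>) * iexp (t * Y \<omega>)) = (CLINT \<omega>|M. cnj (G \<omega> * iexp (- t * Y \<omega>)))"
      by (intro Bochner_Integration.integral_cong) (auto simp: exp_cnj)
    also have "\<dots> = cnj (CLINT \<omega>|M. G \<omega> * iexp (- t * Y \<omega>))"
      by (rule Bochner_Integration.integral_cnj)
    finally show ?thesis
      using ft[of "- t"] by simp
  qed
  have i': "integrable M (\<lambda>\<omega>. cnj (G \<omega>) * iexp (t * Y \<omega>))" for t
    using G by (intro integrable_iexp_mult) auto
  have re: "(CLINT \<omega>|M. Re (G \<omega>) * iexp (t * Y \<omega>)) = 0" for t
  proof -
    have "(CLINT \<omega>|M. Re (G \<omega>) * iexp (t * Y \<omega>))
        = (CLINT \<omega>|M. (G \<omega> * iexp (t * Y \<omega>) + cnj (G \<omega>) * iexp (t * Y \<omega>)) / 2)"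
      by (intro Bochner_Integration.integral_cong) (auto simp: complex_eq_iff algebra_simps)
    then show ?thesis
      using i i' ft ft' by simp
  qed
  have im: "(CLINT \<omega>|M. Im (G \<omega>) * iexp (t * Y \<omega>)) = 0" for t
  proof -
    have "(CLINT \<omega>|M. Im (G \<omega>) * iexp (t * Y \<omega>))
        = (CLINT \<omega>|M. (G \<omega> * iexp (t * Y \<omega>) - cnj (G \<omega>) * iexp (t * Y \<omega>)) / (2 * \<i>))"
      by (intro Bochner_Integration.integral_cong refl)
        (simp add: complex_diff_cnj left_diff_distrib[symmetric], simp add: complex_eq_iff)
    then show ?thesis
      using i i' ft ft' by simp
  qed
  have GB: "integrable M (\<lambda>\<omega>. G \<omega> * indicator B (Y \<omega>))"
    using G by (intro integrable_mult_indicator_comp[OF _ Y B])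
  have "Re (CLINT \<omega>|M. G \<omega> * indicator B (Y \<omega>)) = (LINT \<omega>|M. Re (G \<omega>) * indicator B (Y \<omega>))"
    unfolding integral_Re[OF GB, symmetric]
    by (intro Bochner_Integration.integral_cong) (auto simp: indicator_def)
  moreover have "Im (CLINT \<omega>|M. G \<omega> * indicator B (Y \<omega>)) = (LINT \<omega>|M. Im (G \<omega>) * indicator B (Y \<omega>))"
    unfolding integral_Im[OF GB, symmetric]
    by (intro Bochner_Integration.integral_cong) (auto simp: indicator_def)
  moreover have "(LINT \<omega>|M. Re (G \<omega>) * indicator B (Y \<omega>)) = 0"
    using G by (intro fourier_uniqueness_real re B Y) auto
  moreover have "(LINT \<omega>|M. Im (G \<omega>) * indicator B (Y \<omega>)) = 0"
    using G by (intro fourier_uniqueness_real im B Y) auto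
  ultimately show ?thesis
    by (simp add: complex_eq_iff)
qed

text \<open>Coordinates pass from characters to indicators one at a time. With the character of
  \<open>Y x\<close> absorbed into \<open>G\<close>, the induction hypothesis treats those in
  \<open>K\<close>; with their indicators absorbed instead, one-dimensional uniqueness treats
  \<open>Y x\<close>.\<close>

lemma fourier_uniqueness_boxes:
  fixes G :: "'a \<Rightarrow> complex" and Y :: "'v \<Rightarrow> 'a \<Rightarrow> real"
  assumes "finite K" and "integrable M G"
    and [measurable]: "\<And>k. k \<in> K \<Longrightarrow> Y k \<in> borel_measurable M" "\<And>k. k \<in> K \<Longrightarrow> B k \<in> sets borel"
    and "\<And>t. (CLINT \<omega>|M. G \<omega> * iexp (\<Sum>k\<in>K. t k * Y k \<omega>)) = 0"
  shows "(CLINT \<omega>|M. G \<omega> * (\<Prod>k\<in>K. indicator (B k) (Y k \<omega>))) = 0"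
  using assms
proof (induction K arbitrary: G rule: finite_induct)
  case empty
  then show ?case
    by simp
next
  case (insert x K)
  note [measurable] = insert.prems(2,3)
  let ?J = "\<lambda>\<omega>. \<Prod>k\<in>K. indicator (B k) (Y k \<omega>) :: complex"
  have J: "norm (?J \<omega>) \<le> 1" for \<omega>
    unfolding prod_norm[symmetric] by (intro prod_le_1) (auto simp: indicator_def)
  have Jm [measurable]: "?J \<in> borel_measurable M"
    by (intro borel_measurable_prod) auto
  have "integrable M (\<lambda>\<omega>. G \<omega> * ?J \<omega>)"
    by (rule Bochner_Integration.integrable_bound[OF insert.prems(1)])
      (use insert.prems(1) J in \<open>auto simp: norm_mult intro!: mult_left_le\<close>)
  moreover have "(CLINT \<omega>|M. (G \<omega> * ?J \<omega>) * iexp (s * Y x \<omega>)) = 0" for s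
  proof -
    have "(CLINT \<omega>|M. (G \<omega> * iexp (s * Y x \<omega>)) * ?J \<omega>) = 0"
    proof (rule insert.IH)
      show "integrable M (\<lambda>\<omega>. G \<omega> * iexp (s * Y x \<omega>))"
        using insert.prems(1) by (intro integrable_iexp_mult) auto
      fix t
      have "(\<Sum>k\<in>insert x K. (t(x := s)) k * Y k \<omega>) = s * Y x \<omega> + (\<Sum>k\<in>K. t k * Y k \<omega>)" for \<omega>
        using insert.hyps by (auto intro!: sum.cong)
      then show "(CLINT \<omega>|M. G \<omega> * iexp (s * Y x \<omega>) * iexp (\<Sum>k\<in>K. t k * Y k \<omega>)) = 0"
        using insert.prems(4)[of "t(x := s)"] by (simp add: mult.assoc exp_add[symmetric] distrib_left)
    qed (use insert.prems in auto)
    then show ?thesis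
      by (simp add: mult_ac)
  qed
  ultimately have "(CLINT \<omega>|M. (G \<omega> * ?J \<omega>) * indicator (B x) (Y x \<omega>)) = 0"
    by (intro fourier_uniqueness_complex) auto
  then show ?case
    using insert.hyps by (simp add: mult_ac)
qed

text \<open>The positive and negative parts of \<open>R\<close>, as densities, give two finite
  measures on the product space. They agree on boxes, an intersection-stable generator, hence
  everywhere.\<close>

lemma fourier_uniqueness_PiM:
  fixes R :: "'a \<Rightarrow> real" and Y :: "'v \<Rightarrow> 'a \<Rightarrow> real"
  assumes K: "finite K" and R: "integrable M R"
    and Y: "\<And>k. k \<in> K \<Longrightarrow> Y k \<in> borel_measurable M"
    and ft: "\<And>t. (CLINT \<omega>|M. R \<omega> * iexp (\<Sum>k\<in>K. t k * Y k \<omega>)) = 0"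
    and X: "X \<in> sets (PiM K (\<lambda>_. borel))"
  shows "(LINT \<omega>|M. R \<omega> * indicator X (\<lambda>k\<in>K. Y k \<omega>)) = 0"
proof -
  define P N where "P = (\<lambda>\<omega>. max 0 (R \<omega>))" and "N = (\<lambda>\<omega>. max 0 (- R \<omega>))"
  have Rm [measurable]: "R \<in> borel_measurable M"
    using R by auto
  have PN [measurable]: "integrable M P" "integrable M N" and RPN: "R \<omega> = P \<omega> - N \<omega>"
    and nonneg: "0 \<le> P \<omega>" "0 \<le> N \<omega>" for \<omega>
    using R by (auto simp: P_def N_def)
  let ?Y = "\<lambda>\<omega>. \<lambda>k\<in>K. Y k \<omega>" and ?PiM = "PiM K (\<lambda>_. borel) :: ('v \<Rightarrow> real) measure"
  have Ym [measurable]: "?Y \<in> measurable M ?PiM"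
    using Y by (intro measurable_restrict) auto
  define \<mu> where "\<mu> Q = distr (density M (\<lambda>\<omega>. ennreal (Q \<omega>))) ?PiM ?Y" for Q
  have int: "(LINT x|\<mu> Q. indicator Z x) = (LINT \<omega>|M. Q \<omega> * indicator Z (?Y \<omega>))"
    if [measurable]: "integrable M Q" "Z \<in> sets ?PiM" and "\<And>\<omega>. 0 \<le> Q \<omega>"
    for Q and Z
    unfolding \<mu>_def using that by (subst integral_distr) (auto simp: integral_density)
  have i: "integrable M (\<lambda>\<omega>. Q \<omega> * indicator Z (?Y \<omega>))"
    if "integrable M Q" "Z \<in> sets ?PiM" for Q :: "'a \<Rightarrow> real" and Z
    using that by (intro integrable_mult_indicator_comp[OF _ Ym])
  have diff: "(LINT \<omega>|M. R \<omega> * indicator Z (?Y \<omega>)) = measure (\<mu> P) Z - measure (\<mu> N) Z"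
    if Z: "Z \<in> sets ?PiM" for Z
  proof -
    have "(LINT \<omega>|M. R \<omega> * indicator Z (?Y \<omega>))
        = (LINT \<omega>|M. P \<omega> * indicator Z (?Y \<omega>) - N \<omega> * indicator Z (?Y \<omega>))"
      by (simp add: RPN left_diff_distrib)
    also have "\<dots> = (LINT x|\<mu> P. indicator Z x) - (LINT x|\<mu> N. indicator Z x)"
      using PN nonneg i Z by (subst (1 2) int) auto
    finally show ?thesis
      using Z by (simp add: \<mu>_def)
  qed
  have fin: "finite_measure (\<mu> Q)" if [measurable]: "integrable M Q" and "\<And>\<omega>. 0 \<le> Q \<omega>" for Q
  proof -
    have "(\<integral>\<^sup>+\<omega>. ennreal (Q \<omega>) \<partial>M) = ennreal (integral\<^sup>L M Q)"
      using that by (intro nn_integral_eq_integral) auto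
    then have "finite_measure (density M (\<lambda>\<omega>. ennreal (Q \<omega>)))"
      using that by (intro finite_measureI) (simp add: emeasure_density cong: nn_integral_cong)
    then show ?thesis
      unfolding \<mu>_def by (intro finite_measure.finite_measure_distr) auto
  qed
  interpret P: finite_measure "\<mu> P"
    using fin PN nonneg by auto
  interpret N: finite_measure "\<mu> N"
    using fin PN nonneg by auto
  have box: "measure (\<mu> P) (PiE K B) = measure (\<mu> N) (PiE K B)"
    if B: "\<And>k. k \<in> K \<Longrightarrow> B k \<in> sets borel" for B
  proof -
    have ind: "indicator (PiE K B) (?Y \<omega>) = (\<Prod>k\<in>K. indicator (B k) (Y k \<omega>) :: 'b::comm_semiring_1)" for \<omega>
      using K by (auto simp: indicator_def PiE_iff intro!: prod_zero)
    have "complex_of_real (LINT \<omega>|M. R \<omega> * indicator (PiE K B) (?Y \<omega>))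
        = (CLINT \<omega>|M. complex_of_real (R \<omega>) * (\<Prod>k\<in>K. indicator (B k) (Y k \<omega>)))"
      unfolding integral_complex_of_real[symmetric] ind
      by (intro Bochner_Integration.integral_cong refl)
        (simp add: indicator_def of_bool_def if_distrib[of complex_of_real] cong: if_cong)
    also have "\<dots> = 0"
      using R by (intro fourier_uniqueness_boxes K Y B ft) auto
    finally have "(LINT \<omega>|M. R \<omega> * indicator (PiE K B) (?Y \<omega>)) = 0"
      by simp
    then show ?thesis
      using diff[of "PiE K B"] sets_PiM_I_finite[OF K, of B "\<lambda>_. borel"] B by simp
  qed
  have "\<mu> P = \<mu> N"
  proof (rule measure_eqI_PiM_finite[OF K])
    show "emeasure (\<mu> P) (PiE K B) = emeasure (\<mu> N) (PiE K B)"
      if "\<And>k. k \<in> K \<Longrightarrow> B k \<in> sets borel" for B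
      using box[OF that] by (simp add: P.emeasure_eq_measure N.emeasure_eq_measure)
    \<comment> \<open>The whole space is itself a box, so a constant sequence serves as the
      exhausting cover.\<close>
    show "range (\<lambda>_::nat. PiE K (\<lambda>_. UNIV)) \<subseteq> prod_algebra K (\<lambda>_. borel :: real measure)"
      using K by (auto intro!: prod_algebraI_finite)
    show "emeasure (\<mu> P) (PiE K (\<lambda>_. UNIV)) \<noteq> \<infinity>" for i :: nat
      by simp
  qed (auto simp: \<mu>_def space_PiM)
  then show ?thesis
    using diff[OF X] by simp
qed

section \<open>Conditional expectation and orthogonality\<close>

lemma sigma_gen_subalgebra:
  assumes "\<And>k. k \<in> K \<Longrightarrow> Y k \<in> borel_measurable M"
  shows "finite_measure_subalgebra M (sigma_gen M Y K)"
proof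
  have "(\<lambda>\<omega>. \<lambda>k\<in>K. Y k \<omega>) \<in> measurable M (PiM K (\<lambda>_. borel))"
    using assms by (intro measurable_restrict) auto
  then show "subalgebra M (sigma_gen M Y K)"
    unfolding subalgebra_def sigma_gen_def using sets_image_in_sets[OF refl] by simp
qed

lemma component_measurable_sigma_gen:
  assumes "k \<in> K"
  shows "Y k \<in> borel_measurable (sigma_gen M Y K)"
proof -
  have "(\<lambda>\<omega>. \<lambda>k\<in>K. Y k \<omega>) \<in> measurable (sigma_gen M Y K) (PiM K (\<lambda>_. borel))"
    unfolding sigma_gen_def by (rule measurable_vimage_algebra1) (auto simp: space_PiM)
  from measurable_compose[OF this measurable_component_singleton[OF assms]] show ?thesis
    using assms by simp
qed

text \<open>The sets of \<open>sigma_gen M Y K\<close> are preimages of product-measurable sets, and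
  over these \<open>R\<close> integrates to 0 by Fourier uniqueness.\<close>

lemma real_cond_exp_sigma_gen_eq_0:
  fixes R :: "'a \<Rightarrow> real" and Y :: "'v \<Rightarrow> 'a \<Rightarrow> real"
  assumes K: "finite K" and R: "integrable M R"
    and Y: "\<And>k. k \<in> K \<Longrightarrow> Y k \<in> borel_measurable M"
    and ft: "\<And>t. (CLINT \<omega>|M. R \<omega> * iexp (\<Sum>k\<in>K. t k * Y k \<omega>)) = 0"
  shows "AE \<omega> in M. real_cond_exp M (sigma_gen M Y K) R \<omega> = 0"
proof -
  interpret finite_measure_subalgebra M "sigma_gen M Y K"
    by (rule sigma_gen_subalgebra[OF Y])
  show ?thesis
  proof (rule real_cond_exp_charact)
    fix Z
    assume "Z \<in> sets (sigma_gen M Y K)"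
    then obtain X where X: "X \<in> sets (PiM K (\<lambda>_. borel))" and Z: "Z = (\<lambda>\<omega>. \<lambda>k\<in>K. Y k \<omega>) -` X \<inter> space M"
      unfolding sigma_gen_def by (subst (asm) sets_vimage_algebra2) (auto simp: space_PiM)
    have "(\<integral>\<omega>\<in>Z. R \<omega> \<partial>M) = (LINT \<omega>|M. R \<omega> * indicator X (\<lambda>k\<in>K. Y k \<omega>))"
      unfolding set_lebesgue_integral_def Z
      by (intro Bochner_Integration.integral_cong) (auto simp: indicator_def)
    then show "(\<integral>\<omega>\<in>Z. R \<omega> \<partial>M) = (\<integral>\<omega>\<in>Z. 0 \<partial>M)"
      using fourier_uniqueness_PiM[OF K R Y ft X] by simp
  qed (use R in auto)
qed

text \<open>Conditioning on \<open>X\<close> takes the place of an approximation by simple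
  functions: the orthogonality says that \<open>H\<close> has conditional expectation 0 given
  \<open>X\<close>, and the factor \<open>X\<close> can be pulled out.\<close>

lemma integral_mult_eq_0_of_indicator:
  fixes H X :: "'a \<Rightarrow> real"
  assumes H: "integrable M H" and X [measurable]: "X \<in> borel_measurable M"
    and HX: "integrable M (\<lambda>\<omega>. X \<omega> * H \<omega>)"
    and orth: "\<And>B. B \<in> sets borel \<Longrightarrow> (LINT \<omega>|M. H \<omega> * indicator B (X \<omega>)) = 0"
  shows "(LINT \<omega>|M. X \<omega> * H \<omega>) = 0"
proof -
  let ?F = "vimage_algebra (space M) X borel"
  interpret finite_measure_subalgebra M ?F
    by standard (auto simp: subalgebra_def sets_vimage_algebra2 intro: measurable_sets[OF X])
  have Xm: "X \<in> borel_measurable ?F"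
    by (rule measurable_vimage_algebra1) auto
  have "AE \<omega> in M. real_cond_exp M ?F H \<omega> = 0"
  proof (rule real_cond_exp_charact)
    fix Z
    assume "Z \<in> sets ?F"
    then obtain B where B: "B \<in> sets borel" "Z = X -` B \<inter> space M"
      by (auto simp: sets_vimage_algebra2)
    have "(\<integral>\<omega>\<in>Z. H \<omega> \<partial>M) = (LINT \<omega>|M. H \<omega> * indicator B (X \<omega>))"
      unfolding set_lebesgue_integral_def B
      by (intro Bochner_Integration.integral_cong) (auto simp: indicator_def)
    then show "(\<integral>\<omega>\<in>Z. H \<omega> \<partial>M) = (\<integral>\<omega>\<in>Z. 0 \<partial>M)"
      using orth[OF B(1)] by simp
  qed (use H in auto)
  then have "AE \<omega> in M. X \<omega> * real_cond_exp M ?F H \<omega> = 0"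
    by eventually_elim simp
  then have "(LINT \<omega>|M. X \<omega> * real_cond_exp M ?F H \<omega>) = (LINT \<omega>|M. 0)"
    by (intro integral_cong_AE) auto
  then show ?thesis
    using real_cond_exp_intg(2)[OF HX Xm] H by simp
qed

text \<open>If \<open>p\<close> is the conditional probability of \<open>Z \<in> B\<close> given \<open>F\<close>, conditional independence makes
  \<open>H = 1[Z \<in> B] - p\<close> orthogonal to functions of \<open>X\<close> as well as to those measurable in \<open>F\<close>.\<close>

lemma orthogonal_to_indicator_of_cond_indep:
  fixes X Z R :: "'a \<Rightarrow> real" and F
  assumes F: "finite_measure_subalgebra M F"
    and [measurable]: "X \<in> borel_measurable M" "Z \<in> borel_measurable M" "B \<in> sets borel"
    and X: "integrable M X" and L: "integrable M L" and LF: "L \<in> borel_measurable F"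
    and ci: "cond_indep M F X Z"
    and R: "AE \<omega> in M. real_cond_exp M F (\<lambda>\<omega>. c * X \<omega> + L \<omega>) \<omega> = 0"
  shows "(LINT \<omega>|M. (c * X \<omega> + L \<omega>) * indicator B (Z \<omega>)) = 0"
proof -
  interpret finite_measure_subalgebra M F
    by (rule F)
  let ?I = "indicator {\<omega> \<in> space M. Z \<omega> \<in> B} :: 'a \<Rightarrow> real"
  define p where "p = real_cond_exp M F ?I"
  have [measurable]: "p \<in> borel_measurable F" "p \<in> borel_measurable M"
    by (auto simp: p_def)
  have iI: "integrable M ?I"
    by (intro integrable_real_indicator) (auto simp: emeasure_eq_measure)
  \<comment> \<open>The bounds on \<open>p\<close> keep its products with integrable variables
    integrable.\<close>
  have "AE \<omega> in M. 0 \<le> p \<omega>" "AE \<omega> in M. p \<omega> \<le> 1"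
    unfolding p_def using iI
    by (auto intro!: real_cond_exp_ge_c real_cond_exp_le_c simp: indicator_def)
  then have p01: "AE \<omega> in M. \<bar>p \<omega>\<bar> \<le> 1"
    by eventually_elim auto
  have bdd: "integrable M (\<lambda>\<omega>. f \<omega> * g \<omega>)"
    if "integrable M f" "g \<in> borel_measurable M" "AE \<omega> in M. \<bar>g \<omega>\<bar> \<le> 1" for f g :: "'a \<Rightarrow> real"
  proof (rule Bochner_Integration.integrable_bound[OF that(1)])
    show "AE \<omega> in M. norm (f \<omega> * g \<omega>) \<le> norm (f \<omega>)"
      using that(3) by eventually_elim (simp add: abs_mult mult_left_le)
  qed (use that in auto)
  have ip: "integrable M p"
    using iI by (simp add: p_def real_cond_exp_int)
  have fp: "integrable M (\<lambda>\<omega>. f \<omega> * p \<omega>)" if "integrable M f" for f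
    using that p01 by (intro bdd) auto
  have fI: "integrable M (\<lambda>\<omega>. f \<omega> * ?I \<omega>)" if "integrable M f" for f
    using that by (intro bdd) auto
  define H where "H = (\<lambda>\<omega>. ?I \<omega> - p \<omega>)"
  have iH: "integrable M H"
    using iI ip by (simp add: H_def)
  have fH: "integrable M (\<lambda>\<omega>. f \<omega> * H \<omega>)" if "integrable M f" for f
    using fp[OF that] fI[OF that] by (simp add: H_def right_diff_distrib)
  have "(LINT \<omega>|M. X \<omega> * H \<omega>) = 0"
  proof (rule integral_mult_eq_0_of_indicator[OF iH _ fH[OF X]])
    fix A :: "real set"
    assume A [measurable]: "A \<in> sets borel"
    let ?J = "indicator {\<omega> \<in> space M. X \<omega> \<in> A} :: 'a \<Rightarrow> real"
    let ?IJ = "indicator {\<omega> \<in> space M. X \<omega> \<in> A \<and> Z \<omega> \<in> B} :: 'a \<Rightarrow> real"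
    have "integrable M ?IJ" and iJ: "integrable M ?J"
      by (auto intro!: integrable_real_indicator simp: emeasure_eq_measure)
    \<comment> \<open>Conditional independence rewrites the probability of the joint event; as
      \<open>p\<close> is \<open>F\<close>-measurable, the conditional probability next to it may
      then be replaced by the indicator \<open>?J\<close>.\<close>
    have "AE \<omega> in M. real_cond_exp M F ?IJ \<omega> = real_cond_exp M F ?J \<omega> * p \<omega>"
      using ci A \<open>B \<in> sets borel\<close> unfolding cond_indep_def p_def by blast
    then have "(LINT \<omega>|M. real_cond_exp M F ?IJ \<omega>) = (LINT \<omega>|M. p \<omega> * real_cond_exp M F ?J \<omega>)"
      by (intro integral_cong_AE) (auto elim: eventually_mono)
    then have "integral\<^sup>L M ?IJ = (LINT \<omega>|M. p \<omega> * ?J \<omega>)"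
      using real_cond_exp_int(2)[OF \<open>integrable M ?IJ\<close>] real_cond_exp_intg(2)[of p ?J] fp[OF iJ] iJ
      by (simp add: mult.commute)
    moreover have "(LINT \<omega>|M. H \<omega> * indicator A (X \<omega>)) = (LINT \<omega>|M. ?IJ \<omega> - p \<omega> * ?J \<omega>)"
      by (intro Bochner_Integration.integral_cong) (auto simp: H_def indicator_def)
    ultimately show "(LINT \<omega>|M. H \<omega> * indicator A (X \<omega>)) = 0"
      using \<open>integrable M ?IJ\<close> fp[OF iJ] by (simp add: mult.commute)
  qed auto
  \<comment> \<open>Against the \<open>F\<close>-measurable \<open>L\<close>, \<open>?I\<close> and
    its conditional expectation \<open>p\<close> have the same integral.\<close>
  moreover have "(LINT \<omega>|M. L \<omega> * H \<omega>) = 0"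
    using real_cond_exp_intg(2)[OF fI[OF L] LF] fp[OF L] fI[OF L]
    by (simp add: H_def right_diff_distrib p_def)
  moreover have "(LINT \<omega>|M. (c * X \<omega> + L \<omega>) * p \<omega>) = 0"
  proof -
    have iR: "integrable M (\<lambda>\<omega>. c * X \<omega> + L \<omega>)"
      using X L by simp
    have "AE \<omega> in M. p \<omega> * real_cond_exp M F (\<lambda>\<omega>. c * X \<omega> + L \<omega>) \<omega> = 0"
      using R by eventually_elim simp
    then have "(LINT \<omega>|M. p \<omega> * real_cond_exp M F (\<lambda>\<omega>. c * X \<omega> + L \<omega>) \<omega>) = (LINT \<omega>|M. 0)"
      by (intro integral_cong_AE) auto
    then show ?thesis
      using real_cond_exp_intg(2)[of p "\<lambda>\<omega>. c * X \<omega> + L \<omega>"] fp[OF iR] iR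
      by (simp add: mult.commute[of _ "p _"])
  qed
  \<comment> \<open>Writing the indicator as \<open>H + p\<close> reduces the claim to the three
    relations above.\<close>
  moreover have "(LINT \<omega>|M. (c * X \<omega> + L \<omega>) * indicator B (Z \<omega>))
      = (LINT \<omega>|M. c * (X \<omega> * H \<omega>) + L \<omega> * H \<omega> + (c * X \<omega> + L \<omega>) * p \<omega>)"
    by (intro Bochner_Integration.integral_cong) (auto simp: H_def indicator_def algebra_simps)
  ultimately show ?thesis
    using fH[OF X] fH[OF L] fp[of "\<lambda>\<omega>. c * X \<omega> + L \<omega>"] X L by simp
qed

section \<open>Moments and characteristic functions of Gaussian variables\<close>

lemma gaussian_rv_integrable:
  assumes "gaussian_rv M X"
  shows "integrable M X" "integrable M (\<lambda>\<omega>. (X \<omega>)\<^sup>2)"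
proof -
  have X [measurable]: "X \<in> borel_measurable M"
    using assms by (simp add: gaussian_rv_def)
  consider \<mu> where "AE \<omega> in M. X \<omega> = \<mu>"
    | \<mu> \<sigma> where "0 < \<sigma>" "distributed M lborel X (normal_density \<mu> \<sigma>)"
    using assms by (auto simp: gaussian_rv_def)
  then have "integrable M X \<and> integrable M (\<lambda>\<omega>. (X \<omega>)\<^sup>2)"
  proof cases
    case 1
    have "integrable M X \<longleftrightarrow> integrable M (\<lambda>_. \<mu>)"
      using 1 by (intro integrable_cong_AE) auto
    moreover have "integrable M (\<lambda>\<omega>. (X \<omega>)\<^sup>2) \<longleftrightarrow> integrable M (\<lambda>_. \<mu>\<^sup>2)"
      using 1 by (intro integrable_cong_AE) auto
    ultimately show ?thesis
      by simp
  next
    case 2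
    have i: "integrable M (\<lambda>\<omega>. (X \<omega> - \<mu>) ^ k)" for k
      using distributed_integrable[OF 2(2), of "\<lambda>x. (x - \<mu>) ^ k"] integrable_normal_moment[of \<sigma> \<mu> k] 2(1)
      by simp
    have iX: "integrable M X"
      using Bochner_Integration.integrable_add[OF i[of 1] integrable_const[of \<mu>]] by simp
    have "(X \<omega>)\<^sup>2 = (X \<omega> - \<mu>)\<^sup>2 + 2 * \<mu> * X \<omega> - \<mu>\<^sup>2" for \<omega>
      by (simp add: power2_eq_square algebra_simps)
    then show ?thesis
      using iX i[of 2] by simp
  qed
  then show "integrable M X" "integrable M (\<lambda>\<omega>. (X \<omega>)\<^sup>2)"
    by auto
qed

text \<open>One formula covers both kinds: a constant has variance 0, and otherwise the
  characteristic function of the standardised variable is taken at the standard deviation.\<close>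

lemma gaussian_rv_char:
  assumes "gaussian_rv M X"
  shows "(CLINT \<omega>|M. iexp (X \<omega> - expectation X)) = exp (- variance X / 2)"
proof -
  have X [measurable]: "X \<in> borel_measurable M"
    using assms by (simp add: gaussian_rv_def)
  consider \<mu> where "AE \<omega> in M. X \<omega> = \<mu>"
    | \<mu> \<sigma> where "0 < \<sigma>" "distributed M lborel X (normal_density \<mu> \<sigma>)"
    using assms by (auto simp: gaussian_rv_def)
  then show ?thesis
  proof cases
    case 1
    have "expectation X = (LINT \<omega>|M. \<mu>)"
      using 1 by (intro integral_cong_AE) auto
    then have E: "expectation X = \<mu>"
      by (simp add: prob_space)
    have "(CLINT \<omega>|M. iexp (X \<omega> - \<mu>)) = (CLINT \<omega>|M. 1)"
      using 1 by (intro integral_cong_AE) auto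
    moreover have "(LINT \<omega>|M. (X \<omega> - \<mu>)\<^sup>2) = (LINT \<omega>|M. 0)"
      using 1 by (intro integral_cong_AE) auto
    ultimately show ?thesis
      unfolding E by (simp add: prob_space)
  next
    case 2
    let ?Z = "\<lambda>\<omega>. (X \<omega> - \<mu>) / \<sigma>"
    have D: "distributed M lborel ?Z std_normal_density"
      using 2 normal_standard_normal_convert[of \<sigma> X \<mu>] by simp
    have "(CLINT \<omega>|M. iexp (X \<omega> - \<mu>)) = (CLINT \<omega>|M. iexp (\<sigma> * ?Z \<omega>))"
      using 2(1) by (simp add: of_real_diff[symmetric] of_real_mult[symmetric] del: of_real_diff of_real_mult)
    also have "\<dots> = (CLINT x|distr M lborel ?Z. iexp (\<sigma> * x))"
      by (subst integral_distr) auto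
    also have "\<dots> = char std_normal_distribution \<sigma>"
      unfolding char_def using distributed_distr_eq_density[OF D] by simp
    also have "\<dots> = exp (- \<sigma>\<^sup>2 / 2)"
      by (simp add: char_std_normal_distribution)
    finally show ?thesis
      using normal_distributed_expectation[OF 2] normal_distributed_variance[OF 2] by simp
  qed
qed

end

text \<open>Supplies the dominating function for the difference quotients in
  \<open>uncorrelated_fourier_eq_0\<close>; \<open>sin_scaled_tendsto\<close> supplies their
  limit.\<close>

lemma abs_sin_scaled_le: "\<bar>sin (inverse (real (Suc n)) * x) * real (Suc n)\<bar> \<le> \<bar>x\<bar>"
proof -
  have "\<bar>sin (inverse (real (Suc n)) * x) * real (Suc n)\<bar> \<le> \<bar>inverse (real (Suc n)) * x\<bar> * real (Suc n)"
    unfolding abs_mult[of "sin _"] abs_of_nat by (intro mult_right_mono abs_sin_x_le_abs_x) simp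
  also have "\<dots> = \<bar>x\<bar>"
    by (simp add: abs_mult field_simps del: of_nat_Suc)
  finally show ?thesis .
qed

lemma sin_scaled_tendsto: "(\<lambda>n. sin (inverse (real (Suc n)) * x) * real (Suc n)) \<longlonglongrightarrow> x"
proof -
  have "((\<lambda>u. sin (u * x)) has_real_derivative x) (at 0)"
    by (auto intro!: derivative_eq_intros)
  then have "((\<lambda>h. sin (h * x) / h) \<longlongrightarrow> x) (at 0)"
    by (simp add: DERIV_def)
  moreover have "filterlim (\<lambda>n. inverse (real (Suc n))) (at 0) sequentially"
    using LIMSEQ_inverse_real_of_nat by (auto simp: filterlim_at)
  ultimately have "(\<lambda>n. sin (inverse (real (Suc n)) * x) / inverse (real (Suc n))) \<longlonglongrightarrow> x"
    by (rule filterlim_compose)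
  then show ?thesis
    by (simp add: divide_inverse)
qed

section \<open>Gaussian vectors and zeros of the inverse covariance matrix\<close>

context
  fixes M :: "'a measure" and Y :: "'v::finite \<Rightarrow> 'a \<Rightarrow> real"
  assumes M: "prob_space M" and gv: "gaussian_vector M Y"
begin

interpretation prob_space M
  by (rule M)

abbreviation centred :: "real ^ 'v \<Rightarrow> 'a \<Rightarrow> real" where
  "centred a \<omega> \<equiv> \<Sum>k\<in>UNIV. a $ k * (Y k \<omega> - expectation (Y k))"

lemma gaussian_linear_combination: "gaussian_rv M (\<lambda>\<omega>. \<Sum>k\<in>UNIV. a $ k * Y k \<omega>)"
  using gv by (auto simp: gaussian_vector_def)

lemma gaussian_component: "gaussian_rv M (Y k)"
proof -
  have "(\<Sum>i\<in>UNIV. axis k 1 $ i * Y i \<omega>) = Y k \<omega>" for \<omega>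
    by (simp add: axis_def if_distrib[of "\<lambda>u. u * _"] cong: if_cong)
  then show ?thesis
    using gaussian_linear_combination[of "axis k 1"] by simp
qed

lemma component_measurable [measurable]: "Y k \<in> borel_measurable M"
  using gaussian_component by (simp add: gaussian_rv_def)

lemma component_integrable: "integrable M (Y k)"
  by (rule gaussian_rv_integrable[OF gaussian_component])

lemma component_mult_integrable: "integrable M (\<lambda>\<omega>. Y k \<omega> * Y l \<omega>)"
proof (rule Bochner_Integration.integrable_bound)
  show "integrable M (\<lambda>\<omega>. (Y k \<omega>)\<^sup>2 + (Y l \<omega>)\<^sup>2)"
    using gaussian_rv_integrable(2)[OF gaussian_component] by simp
  have "\<bar>x * y\<bar> \<le> x\<^sup>2 + y\<^sup>2" for x y :: real
    using sum_squares_bound[of "\<bar>x\<bar>" "\<bar>y\<bar>"] abs_ge_zero[of "x * y"]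
    unfolding abs_mult power2_abs by linarith
  then show "AE \<omega> in M. norm (Y k \<omega> * Y l \<omega>) \<le> norm ((Y k \<omega>)\<^sup>2 + (Y l \<omega>)\<^sup>2)"
    by auto
qed auto

lemma centred_mult_integrable:
  "integrable M (\<lambda>\<omega>. (Y k \<omega> - expectation (Y k)) * (Y l \<omega> - expectation (Y l)))"
  using component_mult_integrable[of k l] component_integrable by (simp add: algebra_simps)

lemma centred_integrable: "integrable M (centred a)"
  using component_integrable by simp

lemma centred_eq:
  "centred a \<omega> = (\<Sum>k\<in>UNIV. a $ k * Y k \<omega>) - expectation (\<lambda>\<omega>. \<Sum>k\<in>UNIV. a $ k * Y k \<omega>)"
  using component_integrable by (simp add: right_diff_distrib sum_subtractf)

lemma expectation_centred_mult:
  "expectation (\<lambda>\<omega>. centred a \<omega> * centred b \<omega>) = a \<bullet> (cov_matrix M Y *v b)"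
proof -
  have "expectation (\<lambda>\<omega>. centred a \<omega> * centred b \<omega>)
      = expectation (\<lambda>\<omega>. \<Sum>k\<in>UNIV. \<Sum>l\<in>UNIV. a $ k * b $ l *
          ((Y k \<omega> - expectation (Y k)) * (Y l \<omega> - expectation (Y l))))"
    by (intro Bochner_Integration.integral_cong refl) (simp add: sum_product mult_ac)
  also have "\<dots> = (\<Sum>k\<in>UNIV. \<Sum>l\<in>UNIV. a $ k * b $ l * cov_matrix M Y $ k $ l)"
    using centred_mult_integrable by (simp add: cov_matrix_def covariance_def)
  also have "\<dots> = a \<bullet> (cov_matrix M Y *v b)"
    by (simp add: inner_vec_def matrix_vector_mult_def sum_distrib_left mult_ac)
  finally show ?thesis .
qed

lemma gaussian_centred_char:
  "(CLINT \<omega>|M. iexp (centred a \<omega>)) = exp (- (a \<bullet> (cov_matrix M Y *v a)) / 2)"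
  using gaussian_rv_char[OF gaussian_linear_combination[of a]]
  by (simp only: centred_eq[symmetric] power2_eq_square expectation_centred_mult)

text \<open>With \<open>R = centred a\<close> and \<open>T = centred b\<close>, the variables \<open>T + u R\<close> and \<open>T - u R\<close> have the same
  variance, hence the same characteristic function. So \<open>E[sin (u R) exp (i T)] = 0\<close>; divide by
  \<open>u = 1 / (n + 1)\<close> and let \<open>n\<close> tend to infinity.\<close>

lemma uncorrelated_fourier_eq_0:
  assumes uncor: "a \<bullet> (cov_matrix M Y *v b) = 0"
  shows "(CLINT \<omega>|M. complex_of_real (centred a \<omega>) * iexp (\<Sum>k\<in>UNIV. b $ k * Y k \<omega>)) = 0"
proof -
  let ?S = "cov_matrix M Y" and ?R = "centred a" and ?T = "centred b"
  have sym: "b \<bullet> (?S *v a) = 0"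
    using uncor expectation_centred_mult[of a b] expectation_centred_mult[of b a]
    by (simp add: mult.commute)
  have shift: "centred (b + u *\<^sub>R a) \<omega> = ?T \<omega> + u * ?R \<omega>" for u \<omega>
    by (simp add: distrib_right sum.distrib sum_distrib_left mult.assoc)
  have var: "(b + u *\<^sub>R a) \<bullet> (?S *v (b + u *\<^sub>R a)) = b \<bullet> (?S *v b) + u\<^sup>2 * (a \<bullet> (?S *v a))" for u
    using uncor sym
    by (simp add: matrix_vector_right_distrib inner_add_left inner_add_right
        matrix_vector_mult_scaleR power2_eq_square)
  have i: "integrable M (\<lambda>\<omega>. iexp (f \<omega>))" if [measurable]: "f \<in> borel_measurable M" for f
    using integrable_iexp_mult[of "\<lambda>_. 1" f] by simp
  have sin0: "(CLINT \<omega>|M. complex_of_real (sin (u * ?R \<omega>)) * iexp (?T \<omega>)) = 0" for u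
  proof -
    have "(CLINT \<omega>|M. complex_of_real (sin (u * ?R \<omega>)) * iexp (?T \<omega>))
      = (CLINT \<omega>|M. (iexp (?T \<omega> + u * ?R \<omega>) - iexp (?T \<omega> + (- u) * ?R \<omega>)) / (2 * \<i>))"
    proof (intro Bochner_Integration.integral_cong refl)
      fix \<omega>
      have "iexp (x + y) - iexp (x + - y) = 2 * \<i> * (complex_of_real (sin y) * iexp x)" for x y :: real
        unfolding cis_conv_exp[symmetric] by (simp add: complex_eq_iff cos_add sin_add cos_diff sin_diff)
      from this[of "?T \<omega>" "u * ?R \<omega>"]
      show "complex_of_real (sin (u * ?R \<omega>)) * iexp (?T \<omega>)
        = (iexp (?T \<omega> + u * ?R \<omega>) - iexp (?T \<omega> + (- u) * ?R \<omega>)) / (2 * \<i>)"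
        by (simp only: minus_mult_left) simp
    qed
    also have "\<dots> = ((CLINT \<omega>|M. iexp (?T \<omega> + u * ?R \<omega>)) - (CLINT \<omega>|M. iexp (?T \<omega> + (- u) * ?R \<omega>))) / (2 * \<i>)"
      unfolding integral_divide_zero by (subst Bochner_Integration.integral_diff[OF i i]) auto
    also have "\<dots> = 0"
      unfolding shift[symmetric] gaussian_centred_char var by simp
    finally show ?thesis .
  qed
  have "(\<lambda>n. CLINT \<omega>|M. complex_of_real (sin (inverse (real (Suc n)) * ?R \<omega>) * real (Suc n)) * iexp (?T \<omega>))
      \<longlonglongrightarrow> (CLINT \<omega>|M. complex_of_real (?R \<omega>) * iexp (?T \<omega>))"
  proof (rule integral_dominated_convergence[where w = "\<lambda>\<omega>. \<bar>?R \<omega>\<bar>"])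
    show "integrable M (\<lambda>\<omega>. \<bar>?R \<omega>\<bar>)"
      using centred_integrable by (rule integrable_abs)
    show "AE \<omega> in M. (\<lambda>n. complex_of_real (sin (inverse (real (Suc n)) * ?R \<omega>) * real (Suc n)) * iexp (?T \<omega>))
        \<longlonglongrightarrow> complex_of_real (?R \<omega>) * iexp (?T \<omega>)"
      by (intro AE_I2 tendsto_mult tendsto_of_real tendsto_const sin_scaled_tendsto)
    show "AE \<omega> in M. norm (complex_of_real (sin (inverse (real (Suc n)) * ?R \<omega>) * real (Suc n)) * iexp (?T \<omega>)) \<le> \<bar>?R \<omega>\<bar>" for n
      unfolding norm_mult norm_of_real norm_exp_i_times mult_1_right
      by (intro AE_I2 abs_sin_scaled_le)
  qed auto
  moreover have "(CLINT \<omega>|M. complex_of_real (sin (inverse (real (Suc n)) * ?R \<omega>) * real (Suc n)) * iexp (?T \<omega>)) = 0" for n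
  proof -
    have "(CLINT \<omega>|M. complex_of_real (sin (inverse (real (Suc n)) * ?R \<omega>) * real (Suc n)) * iexp (?T \<omega>))
      = (CLINT \<omega>|M. complex_of_real (real (Suc n)) * (complex_of_real (sin (inverse (real (Suc n)) * ?R \<omega>)) * iexp (?T \<omega>)))"
      by (intro Bochner_Integration.integral_cong refl) (simp add: mult_ac)
    then show ?thesis
      unfolding integral_mult_right_zero sin0 by simp
  qed
  ultimately have "(\<lambda>n. 0) \<longlonglongrightarrow> (CLINT \<omega>|M. complex_of_real (?R \<omega>) * iexp (?T \<omega>))"
    by (simp only:)
  from LIMSEQ_unique[OF this tendsto_const]
  have zero: "(CLINT \<omega>|M. complex_of_real (?R \<omega>) * iexp (?T \<omega>)) = 0" .
  \<comment> \<open>Dropping the centring in the exponent only brings in the constant phase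
    \<open>iexp ?m\<close>.\<close>
  let ?m = "expectation (\<lambda>\<omega>. \<Sum>k\<in>UNIV. b $ k * Y k \<omega>)"
  have "(CLINT \<omega>|M. complex_of_real (?R \<omega>) * iexp (\<Sum>k\<in>UNIV. b $ k * Y k \<omega>))
    = (CLINT \<omega>|M. iexp ?m * (complex_of_real (?R \<omega>) * iexp (?T \<omega>)))"
  proof (intro Bochner_Integration.integral_cong refl)
    fix \<omega>
    have "iexp (\<Sum>k\<in>UNIV. b $ k * Y k \<omega>) = iexp (?m + ?T \<omega>)"
      unfolding centred_eq by simp
    also have "\<dots> = iexp ?m * iexp (?T \<omega>)"
      by (simp add: exp_add[symmetric] distrib_left)
    finally show "complex_of_real (?R \<omega>) * iexp (\<Sum>k\<in>UNIV. b $ k * Y k \<omega>)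
        = iexp ?m * (complex_of_real (?R \<omega>) * iexp (?T \<omega>))"
      by (simp only: mult_ac)
  qed
  then show ?thesis
    unfolding integral_mult_right_zero zero by simp
qed

lemma cond_indep_imp_inverse_entry_eq_0:
  assumes inv: "cov_matrix M Y ** A = mat 1" and A: "transpose A = A" and ij: "i \<noteq> j"
    and ci: "cond_indep M (sigma_gen M Y {k. k \<noteq> i \<and> k \<noteq> j}) (Y i) (Y j)"
  shows "A $ i $ j = 0"
proof -
  let ?K = "{k. k \<noteq> i \<and> k \<noteq> j}" and ?S = "cov_matrix M Y"
  let ?F = "sigma_gen M Y ?K"
  define a where "a = A $ j $ j *\<^sub>R column i A - A $ i $ j *\<^sub>R column j A"
  have Aji: "A $ j $ i = A $ i $ j"
    using arg_cong[OF A, of "\<lambda>B. B $ i $ j"] by (simp add: transpose_def)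
  have aj: "a $ j = 0"
    by (simp add: a_def column_def Aji)
  have Scol: "?S *v column k A = axis k 1" for k
    using arg_cong[OF inv, of "column k"] by (simp add: column_def matrix_matrix_mult_def matrix_vector_mult_def mat_def axis_def vec_eq_iff)
  have Sa: "?S *v a = A $ j $ j *\<^sub>R axis i 1 - A $ i $ j *\<^sub>R axis j 1"
    by (simp add: a_def matrix_vector_mult_diff_distrib matrix_vector_mult_scaleR Scol)
  \<comment> \<open>This vanishes when \<open>b\<close> is supported off \<open>i\<close> and
    \<open>j\<close>, and equals \<open>- A $ i $ j\<close> at \<open>b = axis j 1\<close>; both
    facts are used below.\<close>
  have pair: "expectation (\<lambda>\<omega>. centred b \<omega> * centred a \<omega>) = A $ j $ j * b $ i - A $ i $ j * b $ j" for b
    unfolding expectation_centred_mult Sa by (simp add: inner_diff_right inner_axis)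
  \<comment> \<open>\<open>L\<close> collects the constants and the terms measurable in
    \<open>?F\<close>; there is no \<open>Y j\<close> among them because
    \<open>a $ j = 0\<close>.\<close>
  define L where "L = (\<lambda>\<omega>. (\<Sum>k\<in>?K. a $ k * Y k \<omega>) - (\<Sum>k\<in>UNIV. a $ k * expectation (Y k)))"
  have R: "centred a \<omega> = a $ i * Y i \<omega> + L \<omega>" for \<omega>
  proof -
    have U: "UNIV = insert i (insert j ?K)"
      by auto
    have "(\<Sum>k\<in>UNIV. a $ k * Y k \<omega>) = a $ i * Y i \<omega> + (\<Sum>k\<in>?K. a $ k * Y k \<omega>)"
      by (subst U) (use ij aj in simp)
    then show ?thesis
      by (simp add: L_def right_diff_distrib sum_subtractf)
  qed
  have L: "integrable M L"
    using component_integrable by (simp add: L_def)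
  have [measurable]: "Y k \<in> borel_measurable ?F" if "k \<in> ?K" for k
    using that by (rule component_measurable_sigma_gen)
  have LF: "L \<in> borel_measurable ?F"
    unfolding L_def by measurable
  have F: "finite_measure_subalgebra M ?F"
    by (rule sigma_gen_subalgebra) auto
  have "AE \<omega> in M. real_cond_exp M ?F (centred a) \<omega> = 0"
  proof (rule real_cond_exp_sigma_gen_eq_0)
    fix t :: "'v \<Rightarrow> real"
    define b where "b = (\<chi> k. if k \<in> ?K then t k else 0)"
    have "expectation (\<lambda>\<omega>. centred b \<omega> * centred a \<omega>) = 0"
      unfolding pair by (simp add: b_def)
    then have "a \<bullet> (?S *v b) = 0"
      using expectation_centred_mult[of a b] by (simp only: mult.commute)
    moreover have "(\<Sum>k\<in>UNIV. b $ k * Y k \<omega>) = (\<Sum>k\<in>?K. t k * Y k \<omega>)" for \<omega>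
      by (rule sum.mono_neutral_cong_right) (auto simp: b_def)
    ultimately show "(CLINT \<omega>|M. complex_of_real (centred a \<omega>) * iexp (\<Sum>k\<in>?K. t k * Y k \<omega>)) = 0"
      using uncorrelated_fourier_eq_0[of a b] by simp
  qed (use centred_integrable in auto)
  then have orth: "expectation (\<lambda>\<omega>. centred a \<omega> * indicator B (Y j \<omega>)) = 0" if "B \<in> sets borel" for B
    unfolding R using ci that
    by (intro orthogonal_to_indicator_of_cond_indep[OF F _ _ _ component_integrable L LF]) auto
  have iR: "integrable M (\<lambda>\<omega>. Y j \<omega> * centred a \<omega>)"
    using component_mult_integrable component_integrable by (simp add: sum_distrib_left algebra_simps)
  \<comment> \<open>From indicators of \<open>Y j\<close> to \<open>Y j\<close> itself. Since
    \<open>centred a\<close> has mean 0, centring \<open>Y j\<close> afterwards changes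
    nothing.\<close>
  have "expectation (\<lambda>\<omega>. Y j \<omega> * centred a \<omega>) = 0"
    by (rule integral_mult_eq_0_of_indicator[OF centred_integrable component_measurable iR orth])
  moreover have "expectation (centred a) = 0"
    using component_integrable by (simp add: prob_space)
  moreover have "centred (axis j 1) \<omega> = Y j \<omega> - expectation (Y j)" for \<omega>
    by (simp add: axis_def if_distrib[of "\<lambda>u. u * _"] cong: if_cong)
  then have "expectation (\<lambda>\<omega>. centred (axis j 1) \<omega> * centred a \<omega>)
      = expectation (\<lambda>\<omega>. Y j \<omega> * centred a \<omega> - expectation (Y j) * centred a \<omega>)"
    by (simp only: left_diff_distrib)
  then have "expectation (\<lambda>\<omega>. centred (axis j 1) \<omega> * centred a \<omega>)
      = expectation (\<lambda>\<omega>. Y j \<omega> * centred a \<omega>) - expectation (Y j) * expectation (centred a)"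
    using iR centred_integrable[of a] by (simp only: Bochner_Integration.integral_diff integrable_mult_right integral_mult_right_zero)
  ultimately have "expectation (\<lambda>\<omega>. centred (axis j 1) \<omega> * centred a \<omega>) = 0"
    by (simp only: mult_zero_right diff_0_right)
  then show ?thesis
    unfolding pair using ij by (simp add: axis_def)
qed

end

section \<open>The potential matrix of an acyclic Gauss-Markov field\<close>

theorem theorem1:
  fixes M :: "'a measure"
    and Y :: "'n::{finite,linorder} \<Rightarrow> 'a \<Rightarrow> real"
    and E :: "('n \<times> 'n) set"
    and S A :: "real ^ 'n::{finite,linorder} ^ 'n::{finite,linorder}"
  assumes "prob_space M"
    and "simple_graph E"
    and "GMRF M Y E"
    and "acyclic_graph E"
    and "S = cov_matrix M Y"
    and "pos_definite S"
    and "A = matrix_inv S"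
  shows "(\<forall>i. A $ i $ i = 1 / S $ i $ i *
            (1 + (\<Sum>j\<in>neighbors E i. (S $ i $ j)\<^sup>2 / (S $ i $ i * S $ j $ j - (S $ i $ j)\<^sup>2))))
       \<and> (\<forall>i j. i \<noteq> j \<longrightarrow> A $ i $ j =
            (if (i, j) \<in> E then - S $ i $ j / (S $ i $ i * S $ j $ j - (S $ i $ j)\<^sup>2) else 0))
       \<and> det A = 1 / det S
       \<and> det A = (\<Prod>i\<in>UNIV. S $ i $ i powi (int (deg E i) - 1)) /
            (\<Prod>(i, j)\<in>{(i, j). (i, j) \<in> E \<and> i < j}. S $ i $ i * S $ j $ j - (S $ i $ j)\<^sup>2)"
proof -
  note pd = \<open>pos_definite S\<close> and E = \<open>simple_graph E\<close> \<open>acyclic_graph E\<close>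
  \<comment> \<open>Definiteness gives a trivial kernel, so \<open>matrix_inv S\<close>, a choice
    among candidates, is a genuine inverse.\<close>
  have "x = 0" if "S *v x = 0" for x
    using pd that by (metis inner_zero_right less_irrefl pos_definite_def)
  then have "invertible S"
    using matrix_left_invertible_ker[of S] by (auto simp: invertible_left_inverse)
  then have inv: "A ** S = mat 1"
    unfolding \<open>A = matrix_inv S\<close> invertible_def matrix_inv_def by (rule someI2_ex) simp
  have A0: "A $ i $ j = 0" if "i \<noteq> j" "(i, j) \<notin> E" for i j
  proof (rule cond_indep_imp_inverse_entry_eq_0)
    show "prob_space M" "gaussian_vector M Y" "i \<noteq> j"
      using assms that by (auto simp: GMRF_def)
    show "cov_matrix M Y ** A = mat 1"
      using inv \<open>S = cov_matrix M Y\<close> by (simp add: matrix_left_right_inverse)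
    show "transpose A = A"
      using inverse_sym[OF pd inv] by (simp add: transpose_def vec_eq_iff)
    show "cond_indep M (sigma_gen M Y {k. k \<noteq> i \<and> k \<noteq> j}) (Y i) (Y j)"
      using \<open>GMRF M Y E\<close> that unfolding GMRF_def by blast
  qed
  have "det A * det S = 1"
    using arg_cong[OF inv, of det] by (simp add: det_mul)
  then have "det A = 1 / det S"
    by (metis mult_zero_right nonzero_eq_divide_eq zero_neq_one)
  then show ?thesis
    using forest_inverse_entries[OF pd inv E A0] forest_inverse_det[OF pd inv E A0] A0 by simp
qed

end
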